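(* For $1\le k\le n-1$ the elements $$c_k=\sum_{\sigma,\sigma'\in S_n}(-s)^{l(\sigma)}(-r)^{-l(\sigma')}\,l^{+}_{\sigma(1),\sigma'(1)}\cdots l^{+}_{\sigma(k),\sigma'(k)}\,l^{-}_{\sigma(k+1),\sigma'(k+1)}\cdots l^{-}_{\sigma(n),\sigma'(n)}$$ are quasi-central elements of $U(R)$. Explicitly, $$L^{+}c_k=c_kM^{-1}L^{+}M\qquad\text{and}\qquad c_kL^{-}=M'^{-1}L^{-}M'c_k,$$ where $M=\mathrm{diag}\big((rs)^{n-1},(rs)^{n-2},\ldots,1\big)$ and $M'=\mathrm{diag}\big(1,rs,\ldots,(rs)^{n-1}\big)$.
   Context: Let $n\ge 2$ and let $r,s\in\mathbb{C}$ be nonzero with $r\neq s$ and $[k]_{r,s}:=\frac{s^k-r^k}{s-r}\neq 0$ for $1\le k\le n$ (in particular $r+s\neq 0$). Let $V=\mathbb{C}^n$ with matrix units $e_{ij}$, and let $$R^{(+)}=s\sum_{i}e_{ii}\otimes e_{ii}+rs\sum_{i<j}e_{ii}\otimes e_{jj}+\sum_{i>j}e_{ii}\otimes e_{jj}+(s-r)\sum_{i<j}e_{ij}\otimes e_{ji}\in End(V\otimes V).$$ $U(R)$ is the unital associative $\mathbb{C}$-algebra with generators $l^+_{ij},l^-_{ji}$ ($1\le i\le j\le n$) subject to the relations $$R^{(+)}L_1^{\pm}L_2^{\pm}=L_2^{\pm}L_1^{\pm}R^{(+)},\qquad R^{(+)}L_1^{+}L_2^{-}=L_2^{-}L_1^{+}R^{(+)},$$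 where $L^\pm=(l^\pm_{ij})_{1\le i,j\le n}$ are required to be invertible triangular matrices with $l^+_{ij}=l^-_{ji}=0$ for $1\le j<i\le n$ (so $L^+$ is upper triangular, $L^-$ lower triangular, and the inverses of the diagonal entries are adjoined), and $L_1^\pm=\sum l^\pm_{ij}\,e_{ij}\otimes 1$, $L_2^\pm=\sum l^\pm_{ij}\,1\otimes e_{ij}$. For $\sigma\in S_n$, $l(\sigma)$ denotes the number of inversions. In the claim, $c_k$ multiplies matrices entrywise on the indicated side; "quasi-central" means commuting with the generators $l^\pm_{ij}$ up to the nonzero scalars encoded in the two displayed identities.
   Formalization: The weights in c_k are corrected to (-s)^{-l(σ)}(-r)^{l(σ')}; with the printed (-s)^{l(σ)}(-r)^{-l(σ')} the identities fail already for n=2, k=1 (they would force r²=s²=1, which is excluded). *)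

theory Defs
  imports
    Complex_Main
    "HOL-Library.Poly_Mapping"
    "HOL-Algebra.QuotRing"
    "HOL-Combinatorics.Permutations"
begin

section \<open>The free algebra on the generators\<close>

text \<open>\<^term>\<open>Lp i j\<close> and \<^term>\<open>Lm i j\<close> stand for \<open>l\<^sup>+\<^sub>i\<^sub>j\<close> and \<open>l\<^sup>-\<^sub>i\<^sub>j\<close>; the other two
  constructors are the adjoined inverses of the diagonal generators.\<close>

datatype generator = Lp nat nat | Lm nat nat | Lp_inv nat | Lm_inv nat

definition generators :: "nat \<Rightarrow> generator set" where
  "generators n =
     {Lp i j | i j. 1 \<le> i \<and> i \<le> j \<and> j \<le> n} \<union> {Lm j i | i j. 1 \<le> i \<and> i \<le> j \<and> j \<le> n} \<union>
     {Lp_inv i | i. 1 \<le> i \<and> i \<le> n} \<union> {Lm_inv i | i. 1 \<le> i \<and> i \<le> n}"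

text \<open>Words form an additively written monoid under concatenation, so that
  \<open>word \<Rightarrow>\<^sub>0 complex\<close> is the monoid algebra of noncommutative polynomials.\<close>

datatype word = Word (letters: "generator list")

instantiation word :: monoid_add
begin
definition zero_word :: word where "0 = Word []"
definition plus_word :: "word \<Rightarrow> word \<Rightarrow> word" where "v + w = Word (letters v @ letters w)"
instance by standard (simp_all add: zero_word_def plus_word_def)
end

type_synonym ncpoly = "word \<Rightarrow>\<^sub>0 complex"

definition const :: "complex \<Rightarrow> ncpoly" where
  "const z = Poly_Mapping.single 0 z"

definition var :: "generator \<Rightarrow> ncpoly" where
  "var g = Poly_Mapping.single (Word [g]) 1"

definition free_algebra :: "nat \<Rightarrow> ncpoly ring" where
  "free_algebra n =
     \<lparr>carrier = {p. \<forall>w \<in> Poly_Mapping.keys p. set (letters w) \<subseteq> generators n},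
      monoid.mult = (*), one = 1, zero = 0, add = (+)\<rparr>"

lemma free_algebra_ring: "ring (free_algebra n)"
proof (rule ringI)
  show "abelian_group (free_algebra n)"
  proof (rule abelian_groupI)
    fix x assume "x \<in> carrier (free_algebra n)"
    then show "\<exists>y\<in>carrier (free_algebra n). y \<oplus>\<^bsub>free_algebra n\<^esub> x = \<zero>\<^bsub>free_algebra n\<^esub>"
      by (intro bexI [of _ "- x"]) (auto simp: free_algebra_def)
  next
    fix x y assume "x \<in> carrier (free_algebra n)" "y \<in> carrier (free_algebra n)"
    then show "x \<oplus>\<^bsub>free_algebra n\<^esub> y \<in> carrier (free_algebra n)"
      using Poly_Mapping.keys_add [of x y] by (fastforce simp: free_algebra_def)
  qed (auto simp: free_algebra_def algebra_simps)
next
  show "Group.monoid (free_algebra n)"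
  proof (rule monoidI)
    fix x y assume "x \<in> carrier (free_algebra n)" "y \<in> carrier (free_algebra n)"
    then show "x \<otimes>\<^bsub>free_algebra n\<^esub> y \<in> carrier (free_algebra n)"
      using Poly_Mapping.keys_mult [of x y] by (fastforce simp: free_algebra_def plus_word_def)
  qed (auto simp: free_algebra_def zero_word_def algebra_simps)
qed (auto simp: free_algebra_def algebra_simps)


section \<open>Matrices and the R-matrix\<close>

text \<open>Matrices over a ring \<open>A\<close> are functions of two indices taken from a finite set \<open>I\<close>.\<close>

definition mat_mult :: "('a, 'b) ring_scheme \<Rightarrow> 'i set \<Rightarrow> ('i \<Rightarrow> 'i \<Rightarrow> 'a) \<Rightarrow> ('i \<Rightarrow> 'i \<Rightarrow> 'a) \<Rightarrow> 'i \<Rightarrow> 'i \<Rightarrow> 'a"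
  where "mat_mult A I X Y = (\<lambda>i j. finsum A (\<lambda>k. X i k \<otimes>\<^bsub>A\<^esub> Y k j) I)"

definition unit_mat :: "nat \<Rightarrow> nat \<Rightarrow> nat \<Rightarrow> nat \<Rightarrow> complex" where
  "unit_mat i j = (\<lambda>a b. if a = i \<and> b = j then 1 else 0)"

definition tensor :: "(nat \<Rightarrow> nat \<Rightarrow> complex) \<Rightarrow> (nat \<Rightarrow> nat \<Rightarrow> complex) \<Rightarrow> nat \<times> nat \<Rightarrow> nat \<times> nat \<Rightarrow> complex"
  where "tensor X Y = (\<lambda>p q. X (fst p) (fst q) * Y (snd p) (snd q))"

definition R_plus :: "nat \<Rightarrow> complex \<Rightarrow> complex \<Rightarrow> nat \<times> nat \<Rightarrow> nat \<times> nat \<Rightarrow> complex" where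
  "R_plus n r s = (\<lambda>p q.
       s * (\<Sum>i\<in>{1..n}. tensor (unit_mat i i) (unit_mat i i) p q)
     + r * s * (\<Sum>(i, j)\<in>{(i, j). i \<in> {1..n} \<and> j \<in> {1..n} \<and> i < j}. tensor (unit_mat i i) (unit_mat j j) p q)
     + (\<Sum>(i, j)\<in>{(i, j). i \<in> {1..n} \<and> j \<in> {1..n} \<and> i > j}. tensor (unit_mat i i) (unit_mat j j) p q)
     + (s - r) * (\<Sum>(i, j)\<in>{(i, j). i \<in> {1..n} \<and> j \<in> {1..n} \<and> i < j}. tensor (unit_mat i j) (unit_mat j i) p q))"

text \<open>\<open>L\<^sub>1 = \<Sum> l\<^sub>i\<^sub>j e\<^sub>i\<^sub>j \<otimes> 1\<close> and \<open>L\<^sub>2 = \<Sum> l\<^sub>i\<^sub>j 1 \<otimes> e\<^sub>i\<^sub>j\<close>.\<close>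

definition leg1 :: "(nat \<Rightarrow> nat \<Rightarrow> ncpoly) \<Rightarrow> nat \<times> nat \<Rightarrow> nat \<times> nat \<Rightarrow> ncpoly" where
  "leg1 X = (\<lambda>p q. if snd p = snd q then X (fst p) (fst q) else 0)"

definition leg2 :: "(nat \<Rightarrow> nat \<Rightarrow> ncpoly) \<Rightarrow> nat \<times> nat \<Rightarrow> nat \<times> nat \<Rightarrow> ncpoly" where
  "leg2 X = (\<lambda>p q. if fst p = fst q then X (snd p) (snd q) else 0)"


section \<open>The algebra U(R)\<close>

definition Lp_mat :: "nat \<Rightarrow> nat \<Rightarrow> ncpoly" where
  "Lp_mat i j = (if i \<le> j then var (Lp i j) else 0)"

definition Lm_mat :: "nat \<Rightarrow> nat \<Rightarrow> ncpoly" where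
  "Lm_mat i j = (if j \<le> i then var (Lm i j) else 0)"

text \<open>All entries of \<open>R X\<^sub>1 Y\<^sub>2 - Y\<^sub>2 X\<^sub>1 R\<close>.\<close>

definition RLL_relators ::
  "nat \<Rightarrow> complex \<Rightarrow> complex \<Rightarrow> (nat \<Rightarrow> nat \<Rightarrow> ncpoly) \<Rightarrow> (nat \<Rightarrow> nat \<Rightarrow> ncpoly) \<Rightarrow> ncpoly set" where
  "RLL_relators n r s X Y =
     (let I = {1..n} \<times> {1..n};
          R = (\<lambda>p q. const (R_plus n r s p q));
          mm = mat_mult (free_algebra n) I
      in {mm (mm R (leg1 X)) (leg2 Y) p q - mm (mm (leg2 Y) (leg1 X)) R p q | p q. p \<in> I \<and> q \<in> I})"

definition inverse_relators :: "nat \<Rightarrow> ncpoly set" where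
  "inverse_relators n =
     (\<Union>i\<in>{1..n}. {var (Lp i i) * var (Lp_inv i) - 1, var (Lp_inv i) * var (Lp i i) - 1,
                    var (Lm i i) * var (Lm_inv i) - 1, var (Lm_inv i) * var (Lm i i) - 1})"

definition UR_ideal :: "nat \<Rightarrow> complex \<Rightarrow> complex \<Rightarrow> ncpoly set" where
  "UR_ideal n r s = genideal (free_algebra n)
     (RLL_relators n r s Lp_mat Lp_mat \<union> RLL_relators n r s Lm_mat Lm_mat \<union>
      RLL_relators n r s Lp_mat Lm_mat \<union> inverse_relators n)"

definition UR :: "nat \<Rightarrow> complex \<Rightarrow> complex \<Rightarrow> ncpoly set ring" where
  "UR n r s = free_algebra n Quot UR_ideal n r s"

lemma UR_ring: "ring (UR n r s)"
proof -
  let ?F = "free_algebra n"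
  interpret ring ?F by (rule free_algebra_ring)
  have const: "const z \<in> carrier ?F" for z
    by (auto simp: free_algebra_def const_def zero_word_def)
  have var: "g \<in> generators n \<Longrightarrow> var g \<in> carrier ?F" for g
    by (auto simp: free_algebra_def var_def)
  have zero: "0 \<in> carrier ?F" and one: "1 \<in> carrier ?F"
    by (auto simp: free_algebra_def zero_word_def)
  have mult: "x * y \<in> carrier ?F" if "x \<in> carrier ?F" "y \<in> carrier ?F" for x y
    using m_closed [OF that] by (simp add: free_algebra_def)
  have diff: "x - y \<in> carrier ?F" if "x \<in> carrier ?F" "y \<in> carrier ?F" for x y
    using that Poly_Mapping.keys_diff [of x y] by (fastforce simp: free_algebra_def)
  have mm: "mat_mult ?F I X Y p q \<in> carrier ?F"
    if "\<And>p q. p \<in> I \<Longrightarrow> q \<in> I \<Longrightarrow> X p q \<in> carrier ?F"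
       "\<And>p q. p \<in> I \<Longrightarrow> q \<in> I \<Longrightarrow> Y p q \<in> carrier ?F" "p \<in> I" "q \<in> I"
    for X Y and I :: "(nat \<times> nat) set" and p q
    unfolding mat_mult_def by (intro finsum_closed) (auto intro!: m_closed that)
  have RLL: "RLL_relators n r s X Y \<subseteq> carrier ?F"
    if X: "\<And>i j. i \<in> {1..n} \<Longrightarrow> j \<in> {1..n} \<Longrightarrow> X i j \<in> carrier ?F"
      and Y: "\<And>i j. i \<in> {1..n} \<Longrightarrow> j \<in> {1..n} \<Longrightarrow> Y i j \<in> carrier ?F" for X Y
  proof -
    have 1: "leg1 X p q \<in> carrier ?F" if "p \<in> {1..n} \<times> {1..n}" "q \<in> {1..n} \<times> {1..n}" for p q
      using that X zero unfolding leg1_def mem_Times_iff by presburger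
    have 2: "leg2 Y p q \<in> carrier ?F" if "p \<in> {1..n} \<times> {1..n}" "q \<in> {1..n} \<times> {1..n}" for p q
      using that Y zero unfolding leg2_def mem_Times_iff by presburger
    show ?thesis
      unfolding RLL_relators_def Let_def by (blast intro: diff mm const 1 2)
  qed
  have Lp: "Lp_mat i j \<in> carrier ?F" and Lm: "Lm_mat i j \<in> carrier ?F"
    if "i \<in> {1..n}" "j \<in> {1..n}" for i j
    using that by (auto simp: Lp_mat_def Lm_mat_def generators_def intro!: var zero)
  have inv: "inverse_relators n \<subseteq> carrier ?F"
    by (auto simp: inverse_relators_def generators_def intro!: diff mult var one)
  have "ideal (UR_ideal n r s) ?F"
    unfolding UR_ideal_def
    by (intro genideal_ideal Un_least inv RLL Lp Lm) auto
  then show ?thesis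
    unfolding UR_def by (rule ideal.quotient_is_ring)
qed

definition UR_class :: "nat \<Rightarrow> complex \<Rightarrow> complex \<Rightarrow> ncpoly \<Rightarrow> ncpoly set" where
  "UR_class n r s x = UR_ideal n r s +>\<^bsub>free_algebra n\<^esub> x"

text \<open>The structure map \<open>\<complex> \<rightarrow> U(R)\<close>; scalar multiplication is multiplication by its values.\<close>

definition UR_scalar :: "nat \<Rightarrow> complex \<Rightarrow> complex \<Rightarrow> complex \<Rightarrow> ncpoly set" where
  "UR_scalar n r s z = UR_class n r s (const z)"

definition UR_smult :: "nat \<Rightarrow> complex \<Rightarrow> complex \<Rightarrow> complex \<Rightarrow> ncpoly set \<Rightarrow> ncpoly set" where
  "UR_smult n r s z x = UR_scalar n r s z \<otimes>\<^bsub>UR n r s\<^esub> x"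

definition l_plus :: "nat \<Rightarrow> complex \<Rightarrow> complex \<Rightarrow> nat \<Rightarrow> nat \<Rightarrow> ncpoly set" where
  "l_plus n r s i j = UR_class n r s (Lp_mat i j)"

definition l_minus :: "nat \<Rightarrow> complex \<Rightarrow> complex \<Rightarrow> nat \<Rightarrow> nat \<Rightarrow> ncpoly set" where
  "l_minus n r s i j = UR_class n r s (Lm_mat i j)"

definition UR_diag :: "nat \<Rightarrow> complex \<Rightarrow> complex \<Rightarrow> (nat \<Rightarrow> complex) \<Rightarrow> nat \<Rightarrow> nat \<Rightarrow> ncpoly set" where
  "UR_diag n r s d = (\<lambda>i j. if i = j then UR_scalar n r s (d i) else \<zero>\<^bsub>UR n r s\<^esub>)"

definition UR_mat_mult ::
  "nat \<Rightarrow> complex \<Rightarrow> complex \<Rightarrow> (nat \<Rightarrow> nat \<Rightarrow> ncpoly set) \<Rightarrow> (nat \<Rightarrow> nat \<Rightarrow> ncpoly set) \<Rightarrow> nat \<Rightarrow> nat \<Rightarrow> ncpoly set"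
  where "UR_mat_mult n r s = mat_mult (UR n r s) {1..n}"

definition UR_prod_list :: "nat \<Rightarrow> complex \<Rightarrow> complex \<Rightarrow> ncpoly set list \<Rightarrow> ncpoly set" where
  "UR_prod_list n r s xs = foldr (\<lambda>x y. x \<otimes>\<^bsub>UR n r s\<^esub> y) xs \<one>\<^bsub>UR n r s\<^esub>"

text \<open>Commuting with each generator \<open>l\<^sup>\<plusminus>\<^sub>i\<^sub>j\<close> up to a nonzero scalar.\<close>

definition quasi_central :: "nat \<Rightarrow> complex \<Rightarrow> complex \<Rightarrow> ncpoly set \<Rightarrow> bool" where
  "quasi_central n r s x \<longleftrightarrow>
     x \<in> carrier (UR n r s) \<and>
     (\<forall>i j. 1 \<le> i \<and> i \<le> j \<and> j \<le> n \<longrightarrow>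
        (\<exists>z. z \<noteq> 0 \<and> l_plus n r s i j \<otimes>\<^bsub>UR n r s\<^esub> x = UR_smult n r s z (x \<otimes>\<^bsub>UR n r s\<^esub> l_plus n r s i j)) \<and>
        (\<exists>z. z \<noteq> 0 \<and> l_minus n r s j i \<otimes>\<^bsub>UR n r s\<^esub> x = UR_smult n r s z (x \<otimes>\<^bsub>UR n r s\<^esub> l_minus n r s j i)))"


section \<open>The elements \<open>c\<^sub>k\<close>\<close>

definition rs_number :: "complex \<Rightarrow> complex \<Rightarrow> nat \<Rightarrow> complex" where
  "rs_number r s k = (s ^ k - r ^ k) / (s - r)"

definition inversions :: "nat \<Rightarrow> (nat \<Rightarrow> nat) \<Rightarrow> nat" where
  "inversions n \<sigma> = card {(i, j). 1 \<le> i \<and> i < j \<and> j \<le> n \<and> \<sigma> i > \<sigma> j}"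

text \<open>The weights \<open>(-s)\<^bsup>-l(\<sigma>)\<^esup>\<close> (row indices) and \<open>(-r)\<^bsup>l(\<sigma>')\<^esup>\<close> (column indices) are the coefficients
  of the antisymmetric row and column vectors of \<open>P R\<close>, where \<open>P\<close> is the flip: for \<open>i < j\<close>,
  \<open>e\<^sub>i \<otimes> e\<^sub>j - r e\<^sub>j \<otimes> e\<^sub>i\<close> is a right and \<open>e\<^sub>i\<^sup>* \<otimes> e\<^sub>j\<^sup>* - s\<^bsup>-1\<^esup> e\<^sub>j\<^sup>* \<otimes> e\<^sub>i\<^sup>*\<close> a left eigenvector for the
  eigenvalue \<open>-r\<close>. With the opposite exponents \<open>(-s)\<^bsup>l(\<sigma>)\<^esup> (-r)\<^bsup>-l(\<sigma>')\<^esup>\<close>, which is how the formula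
  is printed in the source, both matrix identities for \<open>c\<^sub>k\<close> are false for this R-matrix: for \<open>n = 2\<close>,
  \<open>r = 3\<close>, \<open>s = 5\<close> they already fail for \<open>c\<^sub>1\<close> in the tensor square of the vector representation.\<close>

definition c_elem :: "nat \<Rightarrow> complex \<Rightarrow> complex \<Rightarrow> nat \<Rightarrow> ncpoly set" where
  "c_elem n r s k =
     finsum (UR n r s)
       (\<lambda>(\<sigma>, \<sigma>'). UR_smult n r s
          ((- s) powi (- int (inversions n \<sigma>)) * (- r) ^ inversions n \<sigma>')
          (UR_prod_list n r s
             (map (\<lambda>i. l_plus n r s (\<sigma> i) (\<sigma>' i)) [1..<Suc k] @
              map (\<lambda>i. l_minus n r s (\<sigma> i) (\<sigma>' i)) [Suc k..<Suc n])))
       ({\<sigma>. \<sigma> permutes {1..n}} \<times> {\<sigma>'. \<sigma>' permutes {1..n}})"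

definition M_entry :: "nat \<Rightarrow> complex \<Rightarrow> complex \<Rightarrow> nat \<Rightarrow> complex" where
  "M_entry n r s i = (r * s) ^ (n - i)"

definition M'_entry :: "complex \<Rightarrow> complex \<Rightarrow> nat \<Rightarrow> complex" where
  "M'_entry r s i = (r * s) ^ (i - 1)"

end

theory Submission
  imports Defs
begin

text \<open>
  Let \<open>\<alpha> = \<Sum> (-s)\<^bsup>-l(\<sigma>)\<^esup> e\<^sub>\<sigma>\<^sup>*\<close> and \<open>\<beta> = \<Sum> (-r)\<^bsup>l(\<sigma>)\<^esup> e\<^sub>\<sigma>\<close> be the antisymmetric row and column vectors
  of the \<open>n\<close>-th tensor power of \<open>V\<close>. Then \<open>c\<^sub>k\<close> is the matrix coefficient \<open>\<alpha> T \<beta>\<close> of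
  \<open>T = L\<^sup>+\<^sub>1 \<dots> L\<^sup>+\<^sub>k L\<^sup>-\<^sub>k\<^sub>+\<^sub>1 \<dots> L\<^sup>-\<^sub>n\<close>. Add one more tensor factor, numbered \<open>0\<close>. The defining relations
  move a matrix acting there through \<open>T\<close> one factor at a time:

  \<open>(R\<^sub>0\<^sub>n \<dots> R\<^sub>0\<^sub>1) L\<^sup>+\<^sub>0 T = T L\<^sup>+\<^sub>0 (R\<^sub>0\<^sub>n \<dots> R\<^sub>0\<^sub>1)\<close> and
  \<open>(R\<^sub>1\<^sub>0 \<dots> R\<^sub>n\<^sub>0) T L\<^sup>-\<^sub>0 = L\<^sup>-\<^sub>0 T (R\<^sub>1\<^sub>0 \<dots> R\<^sub>n\<^sub>0)\<close>.

  Each step exchanges the moved matrix with one factor. Since \<open>L\<^sup>+\<^sub>0\<close> moves only to the right and \<open>L\<^sup>-\<^sub>0\<close> only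
  to the left, the pairs that meet are \<open>L\<^sup>+ L\<^sup>+\<close>, \<open>L\<^sup>+ L\<^sup>-\<close> and \<open>L\<^sup>- L\<^sup>-\<close>, and each of them has a defining relation.
  Contracting with \<open>\<alpha>\<close> and \<open>\<beta>\<close> gives the theorem once the two scalar operators are known to
  act on \<open>V \<otimes> \<beta>\<close> and on \<open>V\<^sup>* \<otimes> \<alpha>\<close> by the same diagonal matrix on the factor \<open>0\<close>: then, for instance,
  \<open>D\<^sub>a l\<^sup>+\<^sub>a\<^sub>b c\<^sub>k = D\<^sub>b c\<^sub>k l\<^sup>+\<^sub>a\<^sub>b\<close> with \<open>D\<^sub>a = s (rs)\<^bsup>n-a\<^esup>\<close>, and \<open>s (rs)\<^bsup>a-1\<^esup>\<close> takes the place of \<open>D\<^sub>a\<close> for \<open>L\<^sup>-\<close>.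

  That action is diagonal for two reasons. First, a sweep of \<open>R\<close> over two adjacent factors
  preserves antisymmetry in them; this is the Yang-Baxter equation on antisymmetric tensors, and
  \<open>R_pair_antisymmetric\<close> checks it on coefficients. An antisymmetric coefficient function vanishes
  on words with a repeated index, so only permutations matter. Secondly, \<open>R\<close> preserves
  the content of a word, and its off-diagonal entries can change the index in the factor \<open>0\<close> in one
  direction only; if the other letters form a permutation before and after, the index in the factor \<open>0\<close>
  returns to its initial value and hence never changed. Only diagonal entries contribute, and their product
  over a permutation is \<open>D\<^sub>a\<close> (\<open>R_sweep_eigenvector\<close>).

  The four cases (rows or columns, \<open>L\<^sup>+\<close> or \<open>L\<^sup>-\<close>) differ by reversing the order of the indices, the
  order of the positions and the roles of the diagonal entries \<open>rs\<close> and \<open>1\<close>. They are treated together by an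
  injective \<open>key\<close>, which is \<open>int\<close> or its negative and orders the indices, and by diagonal
  entries \<open>p\<close> and \<open>q\<close> with \<open>p q = r s\<close>.
\<close>

section \<open>The R-matrix acting on one leg, and antisymmetry\<close>

text \<open>The diagonal entry of \<open>R\<close> at \<open>e\<^sub>a \<otimes> e\<^sub>x\<close>, for the order of the indices given by \<open>key\<close>. The matrix
  \<open>R\<^sup>(\<^sup>+\<^sup>)\<close> itself has \<open>p = r s\<close>, \<open>q = 1\<close> and \<open>key = int\<close>.\<close>

definition R_diag :: "complex \<Rightarrow> complex \<Rightarrow> complex \<Rightarrow> (nat \<Rightarrow> int) \<Rightarrow> nat \<Rightarrow> nat \<Rightarrow> complex" where
  "R_diag s p q key a x = (if key a < key x then p else if key x < key a then q else s)"

text \<open>\<open>R\<^sub>0\<^sub>i\<close> on coefficient functions: the first argument of \<open>g\<close> is the index in the factor \<open>0\<close>, and the word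
  \<open>u\<close> lists the indices in the remaining factors. The reversed key together with \<open>p\<close> and \<open>q\<close>
  exchanged gives the transposed matrix, and the reversed key alone gives \<open>R\<^sub>i\<^sub>0\<close>.\<close>

definition R_leg :: "complex \<Rightarrow> complex \<Rightarrow> complex \<Rightarrow> complex \<Rightarrow> (nat \<Rightarrow> int) \<Rightarrow> nat \<Rightarrow>
    (nat \<Rightarrow> (nat \<Rightarrow> nat) \<Rightarrow> complex) \<Rightarrow> nat \<Rightarrow> (nat \<Rightarrow> nat) \<Rightarrow> complex" where
  "R_leg r s p q key i g = (\<lambda>a u. R_diag s p q key a (u i) * g a u +
     (if key a < key (u i) then (s - r) * g (u i) (u(i := a)) else 0))"

text \<open>For \<open>\<kappa> = -r/q\<close> this puts \<open>v\<close>, as a function of the letters at the positions \<open>i\<close> and \<open>j\<close>, into the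
  eigenspace of the flipped R-matrix for \<open>-r\<close>.\<close>

definition antisymmetric_at :: "complex \<Rightarrow> (nat \<Rightarrow> int) \<Rightarrow> nat \<Rightarrow> nat \<Rightarrow> ((nat \<Rightarrow> nat) \<Rightarrow> complex) \<Rightarrow> bool" where
  "antisymmetric_at \<kappa> key i j v \<longleftrightarrow>
     (\<forall>u x. v (u(i := x, j := x)) = 0) \<and>
     (\<forall>u x y. key x < key y \<longrightarrow> v (u(i := y, j := x)) = \<kappa> * v (u(i := x, j := y)))"

text \<open>The Yang-Baxter equation on the eigenspace of the flipped R-matrix for \<open>-r\<close>: \<open>R\<^sub>0\<^sub>2 R\<^sub>0\<^sub>1\<close> maps \<open>V\<close> tensored
  with this eigenspace to itself. Here \<open>H\<close> is the result of \<open>R\<^sub>0\<^sub>1\<close> and \<open>K\<close> that of \<open>R\<^sub>0\<^sub>2 R\<^sub>0\<^sub>1\<close>. Writing \<open>p\<close> and \<open>r\<close> in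
  terms of \<open>\<kappa>\<close>, \<open>q\<close> and \<open>s\<close> encodes \<open>p q = r s\<close> and \<open>\<kappa> = -r/q\<close> without a division, so that each relative position
  of the three indices leaves a polynomial identity.\<close>

lemma R_pair_antisymmetric:
  fixes G :: "nat \<Rightarrow> nat \<Rightarrow> nat \<Rightarrow> complex"
  assumes key: "inj key" and p: "p = - \<kappa> * s" and r: "r = - \<kappa> * q"
    and zero: "\<And>a x. G a x x = 0"
    and swap: "\<And>a x y. key x < key y \<Longrightarrow> G a y x = \<kappa> * G a x y"
  defines "H \<equiv> \<lambda>a x y. R_diag s p q key a x * G a x y + (if key a < key x then (s - r) * G x a y else 0)"
  defines "K \<equiv> \<lambda>a x y. R_diag s p q key a y * H a x y + (if key a < key y then (s - r) * H y x a else 0)"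
  shows "K a x x = 0" and "key x < key y \<Longrightarrow> K a y x = \<kappa> * K a x y"
proof -
  note defs = K_def H_def R_diag_def zero p r
  consider "key a < key x" | "a = x" | "key x < key a"
    using key by (meson injD linorder_less_linear)
  then show "K a x x = 0"
  proof cases
    case 1
    show ?thesis using 1 by (simp add: defs swap[OF 1] algebra_simps)
  qed (simp_all add: defs)
  assume xy: "key x < key y"
  consider "key a < key x" | "a = x" | "key x < key a \<and> key a < key y" | "a = y" | "key y < key a"
    using key by (meson injD linorder_less_linear)
  then show "K a y x = \<kappa> * K a x y"
  proof cases
    case 1
    then have *: "G a y x = \<kappa> * G a x y" "G x y a = \<kappa> * G x a y" "G y x a = \<kappa> * G y a x"
      using xy by (auto intro!: swap)
    show ?thesis using 1 xy by (simp add: defs * algebra_simps)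
  next
    case 2
    then show ?thesis using xy by (simp add: defs swap[OF xy] algebra_simps)
  next
    case 3
    then have *: "G a y x = \<kappa> * G a x y" "G y a x = \<kappa> * G y x a"
      using xy by (auto intro!: swap)
    show ?thesis using 3 xy by (simp add: defs * algebra_simps)
  next
    case 4
    then show ?thesis using xy by (simp add: defs swap[OF xy] algebra_simps)
  next
    case 5
    then show ?thesis using xy by (simp add: defs swap[OF xy] algebra_simps)
  qed
qed

lemma R_leg_antisymmetric_other:
  assumes "\<And>a. antisymmetric_at \<kappa> key i j (g a)" and "l \<noteq> i" "l \<noteq> j"
  shows "antisymmetric_at \<kappa> key i j (R_leg r s p q key l g a)"
proof -
  have "R_leg r s p q key l g a (u(i := x, j := y)) = R_diag s p q key a (u l) * g a (u(i := x, j := y)) +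
      (if key a < key (u l) then (s - r) * g (u l) (u(l := a, i := x, j := y)) else 0)" for u x y
    using assms(2,3) by (simp add: R_leg_def fun_upd_twist[of l])
  then show ?thesis
    using assms(1) by (simp add: antisymmetric_at_def distrib_left mult.left_commute)
qed

lemma R_leg_antisymmetric_pair:
  assumes key: "inj key" and p: "p = - \<kappa> * s" and r: "r = - \<kappa> * q"
    and g: "\<And>a. antisymmetric_at \<kappa> key i j (g a)" and ij: "i \<noteq> j"
  shows "antisymmetric_at \<kappa> key i j (R_leg r s p q key j (R_leg r s p q key i g) a)"
proof -
  have zero: "g a (u(i := x, j := x)) = 0" for a u x
    using g by (simp add: antisymmetric_at_def)
  have swap: "g a (u(i := y, j := x)) = \<kappa> * g a (u(i := x, j := y))" if "key x < key y" for a u x y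
    using g that by (simp add: antisymmetric_at_def)
  have *: "R_leg r s p q key j (R_leg r s p q key i g) a (u(i := x, j := y)) =
     R_diag s p q key a y * (R_diag s p q key a x * g a (u(i := x, j := y)) +
       (if key a < key x then (s - r) * g x (u(i := a, j := y)) else 0)) +
     (if key a < key y then (s - r) * (R_diag s p q key y x * g y (u(i := x, j := a)) +
       (if key y < key x then (s - r) * g x (u(i := y, j := a)) else 0)) else 0)" for u x y
    using ij by (simp add: R_leg_def fun_upd_twist[of j i])
  show ?thesis
    unfolding antisymmetric_at_def *
    by (intro conjI allI impI R_pair_antisymmetric[OF key p r, of "\<lambda>a x y. g a (u(i := x, j := y))" for u]
        zero swap)
qed

definition R_sweep where
  "R_sweep r s p q key ps g = fold (R_leg r s p q key) ps g"

lemma R_sweep_antisymmetric_other: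
  assumes "\<And>a. antisymmetric_at \<kappa> key i j (g a)" and "i \<notin> set ps" "j \<notin> set ps"
  shows "antisymmetric_at \<kappa> key i j (R_sweep r s p q key ps g a)"
  using assms
proof (induction ps arbitrary: g a)
  case (Cons l ps)
  then show ?case
    using R_leg_antisymmetric_other[of \<kappa> key i j g l] by (simp add: R_sweep_def)
qed (simp add: R_sweep_def)

lemma R_sweep_antisymmetric:
  assumes key: "inj key" and p: "p = - \<kappa> * s" and r: "r = - \<kappa> * q"
    and g: "\<And>a. antisymmetric_at \<kappa> key i j (g a)" and dist: "distinct (xs @ [i, j] @ ys)"
  shows "antisymmetric_at \<kappa> key i j (R_sweep r s p q key (xs @ [i, j] @ ys) g a)"
proof -
  have "R_sweep r s p q key (xs @ [i, j] @ ys) g =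
    R_sweep r s p q key ys (R_leg r s p q key j (R_leg r s p q key i (R_sweep r s p q key xs g)))"
    by (simp add: R_sweep_def)
  then show ?thesis
    using dist by (auto intro!: R_sweep_antisymmetric_other R_leg_antisymmetric_pair[OF key p r] g)
qed

text \<open>Adjacent exchanges multiply \<open>v u\<close> by a nonzero scalar, so two equal letters can be brought next to each
  other, where antisymmetry makes \<open>v\<close> vanish. Antisymmetry may be oriented either way, because a
  sweep can run through the positions upwards or downwards.\<close>

lemma antisymmetric_repetition:
  fixes v :: "(nat \<Rightarrow> nat) \<Rightarrow> complex"
  assumes key: "inj key" and \<kappa>: "\<kappa> \<noteq> 0"
    and v: "\<And>l. 1 \<le> l \<Longrightarrow> l < n \<Longrightarrow> antisymmetric_at \<kappa> key l (Suc l) v \<or> antisymmetric_at \<kappa> key (Suc l) l v"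
    and u: "1 \<le> i" "i < j" "j \<le> n" "u i = u j"
  shows "v u = 0"
  using u
proof (induction "j - i" arbitrary: j u)
  case 0
  then show ?case by simp
next
  case (Suc d)
  \<comment> \<open>The letter at \<open>j\<close> is moved one step to the left, towards the equal letter at \<open>i\<close>.\<close>
  define l where "l = j - 1"
  have l: "j = Suc l" "1 \<le> l" "l < n" "i \<le> l" using Suc.prems by (auto simp: l_def)
  have twist: "w(j := x, l := y) = w(l := y, j := x)" for w :: "nat \<Rightarrow> nat" and x y
    using l(1) by (simp add: fun_upd_twist)
  consider "antisymmetric_at \<kappa> key l j v" | "antisymmetric_at \<kappa> key j l v"
    using v[OF l(2,3)] l(1) by blast
  then have rep_swap: "(\<forall>w x. v (w(l := x, j := x)) = 0) \<and>
      (\<forall>w x y. key x < key y \<longrightarrow> (v (w(l := y, j := x)) = 0 \<longleftrightarrow> v (w(l := x, j := y)) = 0))"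
    using \<kappa> unfolding antisymmetric_at_def by cases (simp_all add: twist)
  then have rep: "v (w(l := x, j := x)) = 0" for w x by blast
  have swap: "v (w(l := y, j := x)) = 0 \<longleftrightarrow> v (w(l := x, j := y)) = 0" for w x y
  proof -
    consider "x = y" | "key x < key y" | "key y < key x"
      using key by (meson injD linorder_less_linear)
    then show ?thesis using rep_swap by cases (simp, blast, blast)
  qed
  show ?case
  proof (cases "i = l")
    case True
    then show ?thesis using rep[of u "u l"] Suc.prems(4) l(1)
      by (metis fun_upd_triv)
  next
    case False
    let ?w = "u(l := u j, j := u l)"
    have "v ?w = 0"
    proof (cases "?w i = ?w l")
      case True
      then show ?thesis using Suc.hyps(1)[of l ?w] Suc.hyps(2) Suc.prems l False by simp
    next
      case neq: False
      then show ?thesis using Suc.prems l False by simp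
    qed
    then show ?thesis using swap[of u "u l" "u j"] by simp
  qed
qed

section \<open>A full sweep of the R-matrix is diagonal on antisymmetric vectors\<close>

text \<open>Words of length \<open>n\<close> in the indices \<open>1, \<dots>, n\<close>, extended by the identity so that the injective words are
  exactly the permutations of \<open>{1..n}\<close>.\<close>

definition index_words :: "nat \<Rightarrow> (nat \<Rightarrow> nat) set" where
  "index_words n = {u. (\<forall>i\<in>{1..n}. u i \<in> {1..n}) \<and> (\<forall>i. i \<notin> {1..n} \<longrightarrow> u i = i)}"

lemma finite_index_words: "finite (index_words n)"
proof -
  have "index_words n \<subseteq> (\<lambda>f i. if i \<in> {1..n} then f i else i) ` (PiE {1..n} (\<lambda>_. {1..n}))"
  proof
    fix u assume "u \<in> index_words n"
    then show "u \<in> (\<lambda>f i. if i \<in> {1..n} then f i else i) ` (PiE {1..n} (\<lambda>_. {1..n}))"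
      by (intro image_eqI[of _ _ "restrict u {1..n}"]) (auto simp: index_words_def fun_eq_iff)
  qed
  then show ?thesis
    by (rule finite_subset) (intro finite_imageI finite_PiE; simp)
qed

lemma permutes_index_words: "u permutes {1..n} \<Longrightarrow> u \<in> index_words n"
  unfolding index_words_def using permutes_in_image[of u "{1..n}"] permutes_not_in[of u "{1..n}"] by blast

lemma index_words_permutes:
  assumes "u \<in> index_words n" and "inj_on u {1..n}"
  shows "u permutes {1..n}"
proof (rule bij_imp_permutes)
  have "u ` {1..n} \<subseteq> {1..n}" using assms(1) by (auto simp: index_words_def)
  then show "bij_betw u {1..n} {1..n}"
    using assms(2) endo_inj_surj[of "{1..n}" u] by (simp add: bij_betw_def)
qed (use assms(1) in \<open>auto simp: index_words_def\<close>)

text \<open>The vector \<open>e\<^sub>b \<otimes> v\<close>, with \<open>e\<^sub>b\<close> in the factor \<open>0\<close>.\<close>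

definition based :: "nat \<Rightarrow> ((nat \<Rightarrow> nat) \<Rightarrow> complex) \<Rightarrow> nat \<Rightarrow> (nat \<Rightarrow> nat) \<Rightarrow> complex" where
  "based b v = (\<lambda>a u. if a = b then v u else 0)"

text \<open>Each step either keeps the index in the factor \<open>0\<close> or exchanges it with a letter, in one direction of the
  order only. The exchange preserves the content of the whole word; its sum is an invariant of the content
  that already determines the index in the factor \<open>0\<close> when the other letters form a permutation.\<close>

lemma R_sweep_based_support:
  assumes v: "\<forall>u. v u \<noteq> 0 \<longrightarrow> u permutes {1..n}" and ps: "set ps \<subseteq> {1..n}"
    and "R_sweep r s p q key ps (based b v) a u \<noteq> 0"
  shows "key a \<le> key b \<and> a + (\<Sum>i\<in>{1..n}. u i) = b + (\<Sum>i\<in>{1..n}. i)"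
  using ps assms(3)
proof (induction ps arbitrary: a u rule: rev_induct)
  case Nil
  then have "a = b" "u permutes {1..n}"
    using v by (auto simp: R_sweep_def based_def split: if_splits)
  then show ?case
    using sum.permute[of u "{1..n}" "\<lambda>i. i"] by simp
next
  case (snoc i ps)
  let ?g = "R_sweep r s p q key ps (based b v)"
  have i: "i \<in> {1..n}" using snoc.prems by simp
  have "R_leg r s p q key i ?g a u \<noteq> 0" using snoc.prems by (simp add: R_sweep_def)
  then have "?g a u \<noteq> 0 \<or> key a < key (u i) \<and> ?g (u i) (u(i := a)) \<noteq> 0"
    by (auto simp: R_leg_def split: if_splits)
  then consider "?g a u \<noteq> 0" | "key a < key (u i)" "?g (u i) (u(i := a)) \<noteq> 0" by blast
  then show ?case
  proof cases
    case 1
    then show ?thesis using snoc by auto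
  next
    case 2
    have "u i + (\<Sum>j\<in>{1..n}. (u(i := a)) j) = a + (\<Sum>j\<in>{1..n}. u j)"
      using sum.remove[OF finite_atLeastAtMost i, of "u(i := a)"] sum.remove[OF finite_atLeastAtMost i, of u]
      by simp
    moreover have "key (u i) \<le> key b \<and> u i + (\<Sum>j\<in>{1..n}. (u(i := a)) j) = b + (\<Sum>i\<in>{1..n}. i)"
      using snoc.IH[OF _ 2(2)] snoc.prems(1) by simp
    ultimately show ?thesis using 2(1) by simp
  qed
qed

text \<open>At a permutation the sum forces \<open>a = b\<close>, and an exchange that left \<open>b\<close> could not come back because the
  key of the index in the factor \<open>0\<close> is monotone. Hence only the diagonal entries survive.\<close>

lemma R_sweep_based_permutation:
  assumes v: "\<forall>u. v u \<noteq> 0 \<longrightarrow> u permutes {1..n}" and ps: "set ps \<subseteq> {1..n}"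
    and u: "u permutes {1..n}"
  shows "R_sweep r s p q key ps (based b v) a u =
    (if a = b then (\<Prod>i\<leftarrow>ps. R_diag s p q key b (u i)) * v u else 0)"
proof (cases "a = b")
  case False
  then have "a + (\<Sum>i\<in>{1..n}. u i) \<noteq> b + (\<Sum>i\<in>{1..n}. i)"
    using sum.permute[OF u, of "\<lambda>i. i"] by simp
  then show ?thesis using R_sweep_based_support[OF v ps] False by metis
next
  case True
  have "R_sweep r s p q key ps (based b v) b u = (\<Prod>i\<leftarrow>ps. R_diag s p q key b (u i)) * v u"
    using ps
  proof (induction ps rule: rev_induct)
    case Nil
    then show ?case by (simp add: R_sweep_def based_def)
  next
    case (snoc i ps)
    let ?g = "R_sweep r s p q key ps (based b v)"
    \<comment> \<open>An exchange would need an index in the factor \<open>0\<close> with a larger key than \<open>b\<close>, which the sweep never produces.\<close>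
    have "?g (u i) (u(i := b)) = 0" if "key b < key (u i)"
      using R_sweep_based_support[OF v, of ps r s p q key b "u i" "u(i := b)"] snoc.prems that by auto
    then show ?case using snoc by (simp add: R_sweep_def R_leg_def)
  qed
  then show ?thesis using True by simp
qed

text \<open>The eigenvalue is a product over all letters of a permutation, hence the same for every permutation. At
  all other words both sides vanish by antisymmetry, which the sweep preserves as it passes through any
  two adjacent positions one right after the other.\<close>

lemma R_sweep_eigenvector:
  assumes key: "inj key" and p: "p = - \<kappa> * s" and r: "r = - \<kappa> * q" and \<kappa>: "\<kappa> \<noteq> 0"
    and ps: "distinct ps" "set ps = {1..n}"
    and v: "\<forall>u. v u \<noteq> 0 \<longrightarrow> u permutes {1..n}"
    and adjacent: "\<And>l. 1 \<le> l \<Longrightarrow> l < n \<Longrightarrow>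
      (\<exists>xs ys. ps = xs @ [l, Suc l] @ ys) \<and> antisymmetric_at \<kappa> key l (Suc l) v \<or>
      (\<exists>xs ys. ps = xs @ [Suc l, l] @ ys) \<and> antisymmetric_at \<kappa> key (Suc l) l v"
    and u: "u \<in> index_words n"
  shows "R_sweep r s p q key ps (based b v) a u = (\<Prod>c\<in>{1..n}. R_diag s p q key b c) * based b v a u"
proof (cases "inj_on u {1..n}")
  case True
  then have perm: "u permutes {1..n}" using u index_words_permutes by blast
  have "(\<Prod>i\<leftarrow>ps. R_diag s p q key b (u i)) = (\<Prod>i\<in>{1..n}. R_diag s p q key b (u i))"
    using ps prod.distinct_set_conv_list[of ps "\<lambda>i. R_diag s p q key b (u i)"] by simp
  also have "\<dots> = (\<Prod>c\<in>{1..n}. R_diag s p q key b c)"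
    using prod.permute[OF perm, of "R_diag s p q key b"] by (simp add: o_def)
  finally show ?thesis
    using R_sweep_based_permutation[OF v _ perm, of ps r s p q key b a] ps(2) by (simp add: based_def)
next
  case False
  then obtain i j where ij: "1 \<le> i" "i < j" "j \<le> n" "u i = u j"
    unfolding inj_on_def by (metis atLeastAtMost_iff linorder_neqE_nat)
  have "v u = 0" using False v permutes_inj_on by blast
  moreover have "R_sweep r s p q key ps (based b v) a u = 0"
  proof (rule antisymmetric_repetition[where v = "R_sweep r s p q key ps (based b v) a", OF key \<kappa> _ ij])
    fix l assume l: "1 \<le> l" "l < n"
    have based: "antisymmetric_at \<kappa> key i j (based b v a)" if "antisymmetric_at \<kappa> key i j v" for i j a
      using that by (simp add: based_def antisymmetric_at_def)
    show "antisymmetric_at \<kappa> key l (Suc l) (R_sweep r s p q key ps (based b v) a) \<or>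
          antisymmetric_at \<kappa> key (Suc l) l (R_sweep r s p q key ps (based b v) a)"
      using adjacent[OF l]
    proof (elim disjE conjE exE)
      fix xs ys assume "ps = xs @ [l, Suc l] @ ys" "antisymmetric_at \<kappa> key l (Suc l) v"
      then show ?thesis
        using R_sweep_antisymmetric[OF key p r, of l "Suc l" "based b v" xs ys a] based ps(1) by simp
    next
      fix xs ys assume "ps = xs @ [Suc l, l] @ ys" "antisymmetric_at \<kappa> key (Suc l) l v"
      then show ?thesis
        using R_sweep_antisymmetric[OF key p r, of "Suc l" l "based b v" xs ys a] based ps(1) by simp
    qed
  qed
  ultimately show ?thesis by (simp add: based_def)
qed

text \<open>The coefficients of \<open>\<alpha>\<close> for \<open>\<kappa> = -1/s\<close> and those of \<open>\<beta>\<close> for \<open>\<kappa> = -r\<close>.\<close>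

definition antisymmetrizer :: "complex \<Rightarrow> nat \<Rightarrow> (nat \<Rightarrow> nat) \<Rightarrow> complex" where
  "antisymmetrizer \<kappa> n u = (if u permutes {1..n} then \<kappa> ^ inversions n u else 0)"

lemma antisymmetrizer_supported: "\<forall>u. antisymmetrizer \<kappa> n u \<noteq> 0 \<longrightarrow> u permutes {1..n}"
  by (simp add: antisymmetrizer_def)

text \<open>Applying the transposition to both positions of a pair matches the inversions of the two words, except for
  the exchanged pair itself, which becomes one new inversion.\<close>

lemma inversions_adjacent_swap:
  assumes l: "1 \<le> l" "Suc l \<le> n" and less: "u l < u (Suc l)"
  shows "inversions n (u \<circ> transpose l (Suc l)) = Suc (inversions n u)"
proof -
  define \<tau> where "\<tau> = transpose l (Suc l)"
  define Inv where "Inv = (\<lambda>u. {(i, j). 1 \<le> i \<and> i < j \<and> j \<le> n \<and> u i > (u j :: nat)})"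
  have fin: "finite (Inv u)" for u
    by (rule finite_subset[of _ "{1..n} \<times> {1..n}"]) (auto simp: Inv_def)
  have inv: "\<tau> (\<tau> i) = i" for i by (simp add: \<tau>_def)
  have bound: "1 \<le> \<tau> i \<and> \<tau> i \<le> n" if "1 \<le> i" "i \<le> n" for i
    using that l by (auto simp: \<tau>_def transpose_def)
  have mono: "\<tau> i < \<tau> j" if "i < j" "(i, j) \<noteq> (l, Suc l)" for i j
    using that by (auto simp: \<tau>_def transpose_def)
  have "Inv (u \<circ> \<tau>) = insert (l, Suc l) (map_prod \<tau> \<tau> ` Inv u)"
  proof (intro equalityI subsetI)
    fix z assume "z \<in> Inv (u \<circ> \<tau>)"
    then obtain i j where z: "z = (i, j)" "1 \<le> i" "i < j" "j \<le> n" "u (\<tau> i) > u (\<tau> j)"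
      by (auto simp: Inv_def)
    show "z \<in> insert (l, Suc l) (map_prod \<tau> \<tau> ` Inv u)"
    proof (cases "z = (l, Suc l)")
      case False
      have "(\<tau> i, \<tau> j) \<in> Inv u"
        using z mono[of i j] False bound[of i] bound[of j] by (auto simp: Inv_def)
      then have "map_prod \<tau> \<tau> (\<tau> i, \<tau> j) \<in> map_prod \<tau> \<tau> ` Inv u" by (rule imageI)
      then show ?thesis using z(1) by (simp add: inv)
    qed simp
  next
    fix z assume "z \<in> insert (l, Suc l) (map_prod \<tau> \<tau> ` Inv u)"
    then consider "z = (l, Suc l)" | i j where "z = (\<tau> i, \<tau> j)" "(i, j) \<in> Inv u" by auto
    then show "z \<in> Inv (u \<circ> \<tau>)"
    proof cases
      case 1
      then show ?thesis using l less by (simp add: Inv_def \<tau>_def)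
    next
      case 2
      then have "(i, j) \<noteq> (l, Suc l)" using less by (auto simp: Inv_def)
      then show ?thesis
        using 2 mono[of i j] bound[of i] bound[of j] by (auto simp: Inv_def inv)
    qed
  qed
  moreover have "(l, Suc l) \<notin> map_prod \<tau> \<tau> ` Inv u"
  proof
    assume "(l, Suc l) \<in> map_prod \<tau> \<tau> ` Inv u"
    then obtain i j where ij: "l = \<tau> i" "Suc l = \<tau> j" "i < j" by (auto simp: Inv_def)
    then have "i = Suc l" "j = l" by (metis inv \<tau>_def transpose_apply_first, metis inv \<tau>_def transpose_apply_second)
    then show False using ij(3) by simp
  qed
  moreover have "inj (map_prod \<tau> \<tau>)"
    by (rule prod.inj_map) (metis inv injI)+
  ultimately have "card (Inv (u \<circ> \<tau>)) = Suc (card (Inv u))"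
    using fin card_image[of "map_prod \<tau> \<tau>" "Inv u"] by (simp add: inj_on_subset)
  then show ?thesis unfolding inversions_def Inv_def \<tau>_def .
qed

lemma antisymmetrizer_antisymmetric:
  assumes l: "1 \<le> l" "l < n"
  shows "antisymmetric_at \<kappa> int l (Suc l) (antisymmetrizer \<kappa> n)"
  unfolding antisymmetric_at_def
proof (intro conjI allI impI)
  fix u and x y :: nat
  have "\<not> inj (u(l := x, Suc l := x))"
    unfolding inj_def by (metis fun_upd_apply n_not_Suc_n)
  then show "antisymmetrizer \<kappa> n (u(l := x, Suc l := x)) = 0"
    using permutes_inj by (auto simp: antisymmetrizer_def)
  assume xy: "int x < int y"
  let ?\<tau> = "transpose l (Suc l)" and ?u = "u(l := x, Suc l := y)"
  have eq: "u(l := y, Suc l := x) = ?u \<circ> ?\<tau>"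
    by (auto simp: fun_eq_iff transpose_def)
  have \<tau>: "?\<tau> permutes {1..n}" using l by (intro permutes_swap_id) auto
  have "?u \<circ> ?\<tau> permutes {1..n} \<longleftrightarrow> ?u permutes {1..n}"
    using permutes_compose[OF \<tau>, of ?u] permutes_compose[OF \<tau>, of "?u \<circ> ?\<tau>"]
    by (auto simp: comp_assoc)
  then show "antisymmetrizer \<kappa> n (u(l := y, Suc l := x)) = \<kappa> * antisymmetrizer \<kappa> n ?u"
    using inversions_adjacent_swap[of l n ?u] l xy unfolding eq by (simp add: antisymmetrizer_def)
qed

lemma upt_adjacent_split:
  assumes "1 \<le> l" "l < n"
  shows "[1..<Suc n] = [1..<l] @ [l, Suc l] @ [Suc (Suc l)..<Suc n]"
  using assms upt_add_eq_append[of 1 l "Suc n - l"] by (simp add: upt_conv_Cons del: upt_Suc)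

text \<open>The eigenvalue counts the \<open>b - 1\<close> indices below \<open>b\<close>, the index \<open>b\<close> itself and the \<open>n - b\<close> indices above. Reversing both
  the key and the order of the positions leaves the same antisymmetry relation, so the downward sweep needs no
  other vectors.\<close>

lemma R_sweep_antisymmetrizer_up:
  assumes p: "p = - \<kappa> * s" and r: "r = - \<kappa> * q" and \<kappa>: "\<kappa> \<noteq> 0"
    and u: "u \<in> index_words n" and b: "b \<in> {1..n}"
  shows "R_sweep r s p q int ([1..<Suc n]) (based b (antisymmetrizer \<kappa> n)) a u =
    (q ^ (b - 1) * s * p ^ (n - b)) * based b (antisymmetrizer \<kappa> n) a u"
proof -
  have split: "{1..n} = {1..<b} \<union> {b} \<union> {b<..n}" using b by auto
  have prod: "(\<Prod>c\<in>{1..n}. R_diag s p q int b c) = (q ^ (b - 1) * s * p ^ (n - b))"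
    unfolding split by (subst prod.union_disjoint; auto simp: R_diag_def)+
  show ?thesis
    unfolding prod[symmetric]
  proof (rule R_sweep_eigenvector[OF _ p r \<kappa> _ _ antisymmetrizer_supported _ u])
    fix l assume l: "1 \<le> l" "l < n"
    show "(\<exists>xs ys. [1..<Suc n] = xs @ [l, Suc l] @ ys) \<and>
          antisymmetric_at \<kappa> int l (Suc l) (antisymmetrizer \<kappa> n) \<or>
        (\<exists>xs ys. [1..<Suc n] = xs @ [Suc l, l] @ ys) \<and>
          antisymmetric_at \<kappa> int (Suc l) l (antisymmetrizer \<kappa> n)"
      using upt_adjacent_split[OF l] antisymmetrizer_antisymmetric[OF l] by blast
  qed (auto simp: inj_def)
qed

lemma R_sweep_antisymmetrizer_down:
  assumes p: "p = - \<kappa> * s" and r: "r = - \<kappa> * q" and \<kappa>: "\<kappa> \<noteq> 0"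
    and u: "u \<in> index_words n" and b: "b \<in> {1..n}"
  shows "R_sweep r s p q (\<lambda>x. - int x) (rev [1..<Suc n]) (based b (antisymmetrizer \<kappa> n)) a u =
    (p ^ (b - 1) * s * q ^ (n - b)) * based b (antisymmetrizer \<kappa> n) a u"
proof -
  have split: "{1..n} = {1..<b} \<union> {b} \<union> {b<..n}" using b by auto
  have prod: "(\<Prod>c\<in>{1..n}. R_diag s p q (\<lambda>x. - int x) b c) = (p ^ (b - 1) * s * q ^ (n - b))"
    unfolding split by (subst prod.union_disjoint; auto simp: R_diag_def)+
  show ?thesis
    unfolding prod[symmetric]
  proof (rule R_sweep_eigenvector[OF _ p r \<kappa> _ _ antisymmetrizer_supported _ u])
    fix l assume l: "1 \<le> l" "l < n"
    have "rev [1..<Suc n] = rev [Suc (Suc l)..<Suc n] @ [Suc l, l] @ rev [1..<l]"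
      unfolding upt_adjacent_split[OF l] rev_append by simp
    moreover have "antisymmetric_at \<kappa> (\<lambda>x. - int x) (Suc l) l (antisymmetrizer \<kappa> n)"
      using antisymmetrizer_antisymmetric[OF l]
      by (simp add: antisymmetric_at_def fun_upd_twist[of "Suc l" l])
    ultimately show "(\<exists>xs ys. rev [1..<Suc n] = xs @ [l, Suc l] @ ys) \<and>
          antisymmetric_at \<kappa> (\<lambda>x. - int x) l (Suc l) (antisymmetrizer \<kappa> n) \<or>
        (\<exists>xs ys. rev [1..<Suc n] = xs @ [Suc l, l] @ ys) \<and>
          antisymmetric_at \<kappa> (\<lambda>x. - int x) (Suc l) l (antisymmetrizer \<kappa> n)"
      by blast
  qed (auto simp: inj_def)
qed

section \<open>The defining relations of U(R) as congruences of noncommutative polynomials\<close>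

lemma const_add: "const (x + y) = const x + const y"
  by (simp add: const_def single_add)

lemma const_mult: "const (x * y) = const x * const y"
  by (simp add: const_def mult_single)

lemma const_0 [simp]: "const 0 = 0"
  by (simp add: const_def)

lemma const_1 [simp]: "const 1 = 1"
  by (simp add: const_def)

lemma const_if_mult: "const (if P then z else 0) * x = (if P then const z * x else 0)"
  by simp

lemma const_commute: "x * const z = const z * x"
proof (induction x rule: update_induct)
  case const
  then show ?case by simp
next
  case (update p w c)
  have "Poly_Mapping.update w c p = Poly_Mapping.single w c + p"
    using update(1) by (intro poly_mapping_eqI)
      (auto simp: lookup_update lookup_add lookup_single when_def in_keys_iff)
  moreover have "Poly_Mapping.single w c * const z = const z * Poly_Mapping.single w c"
    by (simp add: const_def mult_single mult.commute)
  ultimately show ?case using update(3) by (simp add: distrib_left distrib_right)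
qed

lemma const_left_commute: "x * (const z * y) = const z * (x * y)"
  by (metis const_commute mult.assoc)

lemma free_algebra_simps [simp]:
  "x \<otimes>\<^bsub>free_algebra n\<^esub> y = x * y" "\<one>\<^bsub>free_algebra n\<^esub> = 1"
  "x \<oplus>\<^bsub>free_algebra n\<^esub> y = x + y" "\<zero>\<^bsub>free_algebra n\<^esub> = 0"
  by (simp_all add: free_algebra_def)

lemma carrier_const: "const z \<in> carrier (free_algebra n)"
  by (auto simp: free_algebra_def const_def zero_word_def)

lemma carrier_add: "x \<in> carrier (free_algebra n) \<Longrightarrow> y \<in> carrier (free_algebra n) \<Longrightarrow>
    x + y \<in> carrier (free_algebra n)"
  using abelian_groupE(1)[OF ring.is_abelian_group[OF free_algebra_ring[of n]], of x y] by simp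

lemma carrier_mult: "x \<in> carrier (free_algebra n) \<Longrightarrow> y \<in> carrier (free_algebra n) \<Longrightarrow>
    x * y \<in> carrier (free_algebra n)"
  using monoid.m_closed[OF ring.is_monoid[OF free_algebra_ring[of n]], of x y] by simp

lemma carrier_0: "0 \<in> carrier (free_algebra n)" and carrier_1: "1 \<in> carrier (free_algebra n)"
  by (auto simp: free_algebra_def zero_word_def)

lemma carrier_uminus: "x \<in> carrier (free_algebra n) \<Longrightarrow> - x \<in> carrier (free_algebra n)"
  by (auto simp: free_algebra_def)

lemma carrier_diff: "x \<in> carrier (free_algebra n) \<Longrightarrow> y \<in> carrier (free_algebra n) \<Longrightarrow>
    x - y \<in> carrier (free_algebra n)"
  using carrier_add[of x n "- y"] carrier_uminus by simp

lemma carrier_var: "g \<in> generators n \<Longrightarrow> var g \<in> carrier (free_algebra n)"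
  by (auto simp: free_algebra_def var_def)

lemma carrier_sum: "(\<And>i. i \<in> A \<Longrightarrow> f i \<in> carrier (free_algebra n)) \<Longrightarrow> sum f A \<in> carrier (free_algebra n)"
  by (induction A rule: infinite_finite_induct) (auto simp: carrier_0 carrier_add)

lemma carrier_prod_list:
  "(\<And>x. x \<in> set xs \<Longrightarrow> x \<in> carrier (free_algebra n)) \<Longrightarrow> prod_list xs \<in> carrier (free_algebra n)"
  by (induction xs) (auto simp: carrier_1 carrier_mult)

lemma carrier_Lp_mat: "i \<in> {1..n} \<Longrightarrow> j \<in> {1..n} \<Longrightarrow> Lp_mat i j \<in> carrier (free_algebra n)"
  and carrier_Lm_mat: "i \<in> {1..n} \<Longrightarrow> j \<in> {1..n} \<Longrightarrow> Lm_mat i j \<in> carrier (free_algebra n)"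
  by (auto simp: Lp_mat_def Lm_mat_def generators_def intro!: carrier_var carrier_0)

lemma finsum_free_algebra:
  assumes "finite A" and "\<And>i. i \<in> A \<Longrightarrow> f i \<in> carrier (free_algebra n)"
  shows "finsum (free_algebra n) f A = sum f A"
proof -
  interpret ring "free_algebra n" by (rule free_algebra_ring)
  show ?thesis
    using assms
  proof (induction A rule: finite_induct)
    case empty
    then show ?case by simp
  next
    case (insert i A)
    then show ?case by (simp add: finsum_insert Pi_def)
  qed
qed

lemma mat_mult_free_algebra:
  assumes "finite I" and "\<And>k. k \<in> I \<Longrightarrow> X p k \<in> carrier (free_algebra n)"
    and "\<And>k. k \<in> I \<Longrightarrow> Y k q \<in> carrier (free_algebra n)"
  shows "mat_mult (free_algebra n) I X Y p q = (\<Sum>k\<in>I. X p k * Y k q)"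
  unfolding mat_mult_def
  using assms finsum_free_algebra[of I "\<lambda>k. X p k * Y k q" n]
  by (simp add: carrier_mult)

text \<open>Row \<open>(a, i)\<close> of \<open>R\<^sup>(\<^sup>+\<^sup>)\<close> has at most two nonzero entries. They are kept as separate summands, since for \<open>a = i\<close> the two
  columns coincide and the second summand is \<open>0\<close>.\<close>

lemma R_plus_entry:
  assumes "a \<in> {1..n}" "i \<in> {1..n}"
  shows "R_plus n r s (a, i) (b, j) =
    (if (b, j) = (a, i) then R_diag s (r * s) 1 int a i else 0) +
    (if (b, j) = (i, a) then (if a < i then s - r else 0) else 0)"
proof -
  have 1: "(\<Sum>l\<in>{1..n}. tensor (unit_mat l l) (unit_mat l l) (a, i) (b, j)) =
      (if a = i \<and> b = a \<and> j = a then 1 else 0)"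
  proof -
    have "(\<Sum>l\<in>{1..n}. tensor (unit_mat l l) (unit_mat l l) (a, i) (b, j)) =
      (\<Sum>l\<in>{1..n}. if l = a then (if a = i \<and> b = a \<and> j = a then 1 else 0) else 0)"
      by (rule sum.cong) (auto simp: tensor_def unit_mat_def)
    then show ?thesis using assms by simp
  qed
  have pairs: "(\<Sum>(l, m)\<in>{(l, m). l \<in> {1..n} \<and> m \<in> {1..n} \<and> P l m}. f l m) = (if P a i then f a i else 0)"
    if "\<And>l m. (l, m) \<noteq> (a, i) \<Longrightarrow> f l m = 0" for P and f :: "nat \<Rightarrow> nat \<Rightarrow> complex"
  proof -
    have fin: "finite {(l, m). l \<in> {1..n} \<and> m \<in> {1..n} \<and> P l m}"
      by (rule finite_subset[of _ "{1..n} \<times> {1..n}"]) auto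
    have "(\<Sum>(l, m)\<in>{(l, m). l \<in> {1..n} \<and> m \<in> {1..n} \<and> P l m}. f l m) =
      (\<Sum>z\<in>{(l, m). l \<in> {1..n} \<and> m \<in> {1..n} \<and> P l m}. if z = (a, i) then f a i else 0)"
      using that by (intro sum.cong refl) (auto split: prod.splits)
    then show ?thesis using fin assms by simp
  qed
  have 2: "(\<Sum>(l, m)\<in>{(l, m). l \<in> {1..n} \<and> m \<in> {1..n} \<and> P l m}.
      tensor (unit_mat l l) (unit_mat m m) (a, i) (b, j)) = (if P a i then (if (b, j) = (a, i) then 1 else 0) else 0)" for P
    by (subst pairs) (auto simp: tensor_def unit_mat_def)
  have 3: "(\<Sum>(l, m)\<in>{(l, m). l \<in> {1..n} \<and> m \<in> {1..n} \<and> P l m}.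
      tensor (unit_mat l m) (unit_mat m l) (a, i) (b, j)) = (if P a i then (if (b, j) = (i, a) then 1 else 0) else 0)" for P
    by (subst pairs) (auto simp: tensor_def unit_mat_def)
  have entry: "R_plus n r s (a, i) (b, j) = s * (if a = i \<and> b = a \<and> j = a then 1 else 0) +
      r * s * (if a < i then (if (b, j) = (a, i) then 1 else 0) else 0) +
      (if i < a then (if (b, j) = (a, i) then 1 else 0) else 0) +
      (s - r) * (if a < i then (if (b, j) = (i, a) then 1 else 0) else 0)"
    by (simp only: R_plus_def 1 2[of "\<lambda>l m. l < m"] 2[of "\<lambda>l m. m < l"] 3[of "\<lambda>l m. l < m"])
  consider "a < i" | "a = i" | "i < a" by linarith
  then show ?thesis
    unfolding entry by cases (simp_all add: R_diag_def)
qed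

lemma sum_R_plus_row:
  assumes "a \<in> {1..n}" "i \<in> {1..n}"
  shows "(\<Sum>k\<in>{1..n} \<times> {1..n}. const (R_plus n r s (a, i) k) * Z k) =
    const (R_diag s (r * s) 1 int a i) * Z (a, i) + (if a < i then const (s - r) * Z (i, a) else 0)"
proof -
  have "(\<Sum>k\<in>{1..n} \<times> {1..n}. const (R_plus n r s (a, i) k) * Z k) =
    (\<Sum>k\<in>{1..n} \<times> {1..n}. (if k = (a, i) then const (R_diag s (r * s) 1 int a i) * Z k else 0) +
       (if k = (i, a) then const (if a < i then s - r else 0) * Z k else 0))"
  proof (intro sum.cong refl)
    fix k :: "nat \<times> nat"
    obtain b j where k: "k = (b, j)" by (cases k)
    show "const (R_plus n r s (a, i) k) * Z k =
      (if k = (a, i) then const (R_diag s (r * s) 1 int a i) * Z k else 0) +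
       (if k = (i, a) then const (if a < i then s - r else 0) * Z k else 0)"
      unfolding k R_plus_entry[OF assms] const_add distrib_right const_if_mult ..
  qed
  also have "\<dots> = const (R_diag s (r * s) 1 int a i) * Z (a, i) + const (if a < i then s - r else 0) * Z (i, a)"
    using assms by (simp add: sum.distrib)
  finally show ?thesis by (simp only: const_if_mult)
qed

lemma sum_R_plus_column:
  assumes "b \<in> {1..n}" "j \<in> {1..n}"
  shows "(\<Sum>k\<in>{1..n} \<times> {1..n}. Z k * const (R_plus n r s k (b, j))) =
    const (R_diag s (r * s) 1 int b j) * Z (b, j) + (if j < b then const (s - r) * Z (j, b) else 0)"
proof -
  have entry: "R_plus n r s k (b, j) = (if k = (b, j) then R_diag s (r * s) 1 int b j else 0) +
      (if k = (j, b) then (if j < b then s - r else 0) else 0)" if mem: "k \<in> {1..n} \<times> {1..n}" for k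
  proof -
    obtain x y where k: "k = (x, y)" and xy: "x \<in> {1..n}" "y \<in> {1..n}" using mem by (rule SigmaE)
    have "(if (b, j) = (x, y) then R_diag s (r * s) 1 int x y else 0) =
        (if (x, y) = (b, j) then R_diag s (r * s) 1 int b j else 0)"
      by (rule if_cong) auto
    moreover have "(if (b, j) = (y, x) then (if x < y then s - r else 0) else 0) =
        (if (x, y) = (j, b) then (if j < b then s - r else 0) else 0)"
      by (rule if_cong) auto
    ultimately show ?thesis
      unfolding k R_plus_entry[OF xy] by (rule arg_cong2)
  qed
  have "(\<Sum>k\<in>{1..n} \<times> {1..n}. Z k * const (R_plus n r s k (b, j))) =
    (\<Sum>k\<in>{1..n} \<times> {1..n}. (if k = (b, j) then const (R_diag s (r * s) 1 int b j) * Z k else 0) +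
       (if k = (j, b) then const (if j < b then s - r else 0) * Z k else 0))"
  proof (intro sum.cong refl)
    fix k assume k: "k \<in> {1..n} \<times> {1..n}"
    show "Z k * const (R_plus n r s k (b, j)) =
      (if k = (b, j) then const (R_diag s (r * s) 1 int b j) * Z k else 0) +
       (if k = (j, b) then const (if j < b then s - r else 0) * Z k else 0)"
      unfolding entry[OF k] const_add distrib_left const_commute[of "Z k"] const_if_mult ..
  qed
  also have "\<dots> = const (R_diag s (r * s) 1 int b j) * Z (b, j) + const (if j < b then s - r else 0) * Z (j, b)"
    using assms by (simp add: sum.distrib)
  finally show ?thesis by (simp only: const_if_mult)
qed

lemma sum_leg1_leg2:
  assumes "b \<in> {1..n}" "i \<in> {1..n}"
  shows "(\<Sum>k\<in>{1..n} \<times> {1..n}. leg1 X (a, i) k * leg2 Y k (b, j)) = X a b * Y i j"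
proof -
  have "(\<Sum>k\<in>{1..n} \<times> {1..n}. leg1 X (a, i) k * leg2 Y k (b, j)) =
      (\<Sum>k\<in>{1..n} \<times> {1..n}. if k = (b, i) then X a b * Y i j else 0)"
    by (intro sum.cong refl) (auto simp: leg1_def leg2_def prod_eq_iff)
  then show ?thesis using assms by simp
qed

lemma sum_leg2_leg1:
  assumes "a \<in> {1..n}" "j \<in> {1..n}"
  shows "(\<Sum>k\<in>{1..n} \<times> {1..n}. leg2 Y (a, i) k * leg1 X k (b, j)) = Y i j * X a b"
proof -
  have "(\<Sum>k\<in>{1..n} \<times> {1..n}. leg2 Y (a, i) k * leg1 X k (b, j)) =
      (\<Sum>k\<in>{1..n} \<times> {1..n}. if k = (a, j) then Y i j * X a b else 0)"
    by (intro sum.cong refl) (auto simp: leg1_def leg2_def prod_eq_iff)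
  then show ?thesis using assms by simp
qed

text \<open>The entries of \<open>R X\<^sub>1 Y\<^sub>2\<close> and of \<open>Y\<^sub>2 X\<^sub>1 R\<close> in row \<open>(a, i)\<close> and column \<open>(b, j)\<close>.\<close>

definition RLL_left where
  "RLL_left r s X Y a i b j = const (R_diag s (r * s) 1 int a i) * (X a b * Y i j) +
     (if a < i then const (s - r) * (X i b * Y a j) else (0 :: ncpoly))"

definition RLL_right where
  "RLL_right r s X Y a i b j = const (R_diag s (r * s) 1 int b j) * (Y i j * X a b) +
     (if j < b then const (s - r) * (Y i b * X a j) else (0 :: ncpoly))"

lemma RLL_relators_entries:
  assumes X: "\<And>i j. i \<in> {1..n} \<Longrightarrow> j \<in> {1..n} \<Longrightarrow> X i j \<in> carrier (free_algebra n)"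
    and Y: "\<And>i j. i \<in> {1..n} \<Longrightarrow> j \<in> {1..n} \<Longrightarrow> Y i j \<in> carrier (free_algebra n)"
  shows "RLL_relators n r s X Y =
    {RLL_left r s X Y a i b j - RLL_right r s X Y a i b j | a i b j.
      a \<in> {1..n} \<and> i \<in> {1..n} \<and> b \<in> {1..n} \<and> j \<in> {1..n}}"
proof -
  define I where "I = {1..n} \<times> {1..n}"
  define R where "R = (\<lambda>p q. const (R_plus n r s p q))"
  let ?mm = "mat_mult (free_algebra n) I"
  have fin: "finite I" by (simp add: I_def)
  have R: "R p q \<in> carrier (free_algebra n)" for p q by (simp add: R_def carrier_const)
  have 1: "leg1 X p q \<in> carrier (free_algebra n)" if "p \<in> I" "q \<in> I" for p q
    using that X carrier_0 unfolding I_def leg1_def mem_Times_iff by presburger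
  have 2: "leg2 Y p q \<in> carrier (free_algebra n)" if "p \<in> I" "q \<in> I" for p q
    using that Y carrier_0 unfolding I_def leg2_def mem_Times_iff by presburger
  have left: "?mm (?mm R (leg1 X)) (leg2 Y) p q = RLL_left r s X Y a i b j"
    if pq: "p = (a, i)" "q = (b, j)" "p \<in> I" "q \<in> I" for p q a i b j
  proof -
    have ai: "a \<in> {1..n}" "i \<in> {1..n}" and bj: "b \<in> {1..n}" "j \<in> {1..n}" using pq by (auto simp: I_def)
    have inner: "?mm R (leg1 X) p k = const (R_diag s (r * s) 1 int a i) * leg1 X (a, i) k +
        (if a < i then const (s - r) * leg1 X (i, a) k else 0)" if "k \<in> I" for k
    proof -
      have "?mm R (leg1 X) p k = (\<Sum>l\<in>I. R p l * leg1 X l k)"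
        using that by (intro mat_mult_free_algebra) (simp_all add: fin R 1)
      then show ?thesis unfolding R_def pq I_def by (simp only: sum_R_plus_row[OF ai])
    qed
    have closed: "?mm R (leg1 X) p k \<in> carrier (free_algebra n)" if "k \<in> I" for k
      using that ai pq(1) unfolding inner[OF that]
      by (auto intro!: carrier_add carrier_mult carrier_const carrier_0 1 simp: I_def)
    have "?mm (?mm R (leg1 X)) (leg2 Y) p q = (\<Sum>k\<in>I. ?mm R (leg1 X) p k * leg2 Y k q)"
      using closed pq(4) by (intro mat_mult_free_algebra) (simp_all add: fin 2)
    also have "\<dots> = const (R_diag s (r * s) 1 int a i) * (\<Sum>k\<in>I. leg1 X (a, i) k * leg2 Y k (b, j)) +
        (if a < i then const (s - r) * (\<Sum>k\<in>I. leg1 X (i, a) k * leg2 Y k (b, j)) else 0)"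
      by (simp add: inner pq(2) distrib_right sum.distrib sum_distrib_left mult.assoc)
    finally show ?thesis
      unfolding RLL_left_def I_def sum_leg1_leg2[OF bj(1) ai(2)] sum_leg1_leg2[OF bj(1) ai(1)] .
  qed
  have right: "?mm (?mm (leg2 Y) (leg1 X)) R p q = RLL_right r s X Y a i b j"
    if pq: "p = (a, i)" "q = (b, j)" "p \<in> I" "q \<in> I" for p q a i b j
  proof -
    have ai: "a \<in> {1..n}" "i \<in> {1..n}" and bj: "b \<in> {1..n}" "j \<in> {1..n}" using pq by (auto simp: I_def)
    have inner: "?mm (leg2 Y) (leg1 X) p (c, d) = Y i d * X a c" if "(c, d) \<in> I" for c d
    proof -
      have "?mm (leg2 Y) (leg1 X) p (c, d) = (\<Sum>l\<in>I. leg2 Y p l * leg1 X l (c, d))"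
        using that pq(3) by (intro mat_mult_free_algebra) (simp_all add: fin 1 2)
      then show ?thesis using that ai unfolding pq I_def by (simp only: sum_leg2_leg1 mem_Times_iff fst_conv snd_conv)
    qed
    have closed: "?mm (leg2 Y) (leg1 X) p k \<in> carrier (free_algebra n)" if "k \<in> I" for k
    proof -
      obtain c d where "k = (c, d)" "c \<in> {1..n}" "d \<in> {1..n}"
        using \<open>k \<in> I\<close> unfolding I_def by (rule SigmaE)
      then show ?thesis
        using that ai inner[of c d] by (simp add: X Y carrier_mult del: One_nat_def)
    qed
    have "?mm (?mm (leg2 Y) (leg1 X)) R p q = (\<Sum>k\<in>I. ?mm (leg2 Y) (leg1 X) p k * R k q)"
      using closed by (intro mat_mult_free_algebra) (simp_all add: fin R)
    also have "\<dots> = const (R_diag s (r * s) 1 int b j) * ?mm (leg2 Y) (leg1 X) p (b, j) +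
        (if j < b then const (s - r) * ?mm (leg2 Y) (leg1 X) p (j, b) else 0)"
      unfolding R_def pq(2) by (rule sum_R_plus_column[OF bj, folded I_def])
    finally have eq: "?mm (?mm (leg2 Y) (leg1 X)) R p q =
      const (R_diag s (r * s) 1 int b j) * ?mm (leg2 Y) (leg1 X) p (b, j) +
        (if j < b then const (s - r) * ?mm (leg2 Y) (leg1 X) p (j, b) else 0)" .
    have "(b, j) \<in> I" "(j, b) \<in> I" using bj by (simp_all add: I_def)
    then show ?thesis
      unfolding eq RLL_right_def by (simp only: inner)
  qed
  have "RLL_relators n r s X Y =
      {?mm (?mm R (leg1 X)) (leg2 Y) p q - ?mm (?mm (leg2 Y) (leg1 X)) R p q | p q. p \<in> I \<and> q \<in> I}"
    by (simp add: RLL_relators_def Let_def I_def R_def)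
  also have "\<dots> = {RLL_left r s X Y a i b j - RLL_right r s X Y a i b j | a i b j. (a, i) \<in> I \<and> (b, j) \<in> I}"
    (is "?A = ?B")
  proof (intro equalityI subsetI)
    fix x assume "x \<in> ?A"
    then obtain a i b j where "(a, i) \<in> I" "(b, j) \<in> I"
        "x = ?mm (?mm R (leg1 X)) (leg2 Y) (a, i) (b, j) - ?mm (?mm (leg2 Y) (leg1 X)) R (a, i) (b, j)"
      by auto
    then show "x \<in> ?B" using left[OF refl refl] right[OF refl refl] by auto
  next
    fix x assume "x \<in> ?B"
    then obtain a i b j where *: "(a, i) \<in> I" "(b, j) \<in> I"
        "x = RLL_left r s X Y a i b j - RLL_right r s X Y a i b j" by auto
    then have "x = ?mm (?mm R (leg1 X)) (leg2 Y) (a, i) (b, j) - ?mm (?mm (leg2 Y) (leg1 X)) R (a, i) (b, j)"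
      using left[OF refl refl] right[OF refl refl] by simp
    then show "x \<in> ?A" using * by blast
  qed
  finally show ?thesis by (auto simp: I_def)
qed

definition UR_relators :: "nat \<Rightarrow> complex \<Rightarrow> complex \<Rightarrow> ncpoly set" where
  "UR_relators n r s = RLL_relators n r s Lp_mat Lp_mat \<union> RLL_relators n r s Lm_mat Lm_mat \<union>
      RLL_relators n r s Lp_mat Lm_mat \<union> inverse_relators n"

lemma UR_relators_carrier: "UR_relators n r s \<subseteq> carrier (free_algebra n)"
proof -
  have "RLL_relators n r s X Y \<subseteq> carrier (free_algebra n)"
    if X: "\<And>i j. i \<in> {1..n} \<Longrightarrow> j \<in> {1..n} \<Longrightarrow> X i j \<in> carrier (free_algebra n)"
      and Y: "\<And>i j. i \<in> {1..n} \<Longrightarrow> j \<in> {1..n} \<Longrightarrow> Y i j \<in> carrier (free_algebra n)" for X Y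
  proof -
    have "RLL_relators n r s X Y =
      {RLL_left r s X Y a i b j - RLL_right r s X Y a i b j | a i b j.
        a \<in> {1..n} \<and> i \<in> {1..n} \<and> b \<in> {1..n} \<and> j \<in> {1..n}}"
      using X Y by (rule RLL_relators_entries)
    then show ?thesis
      unfolding RLL_left_def RLL_right_def
      by (auto intro!: carrier_diff carrier_add carrier_mult carrier_const carrier_0 X Y)
  qed
  moreover have "inverse_relators n \<subseteq> carrier (free_algebra n)"
    by (auto simp: inverse_relators_def generators_def intro!: carrier_diff carrier_mult carrier_var carrier_1)
  ultimately show ?thesis
    using carrier_Lp_mat carrier_Lm_mat by (simp add: UR_relators_def)
qed

lemma UR_ideal_ideal: "ideal (UR_ideal n r s) (free_algebra n)"
  unfolding UR_ideal_def UR_relators_def[symmetric]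
  by (rule ring.genideal_ideal[OF free_algebra_ring UR_relators_carrier])

lemma UR_relators_ideal: "UR_relators n r s \<subseteq> UR_ideal n r s"
  unfolding UR_ideal_def UR_relators_def[symmetric]
  by (rule ring.genideal_self[OF free_algebra_ring UR_relators_carrier])

lemma UR_ideal_0: "0 \<in> UR_ideal n r s"
  using additive_subgroup.zero_closed[OF ideal.axioms(1)[OF UR_ideal_ideal]] by simp

lemma UR_ideal_add: "x \<in> UR_ideal n r s \<Longrightarrow> y \<in> UR_ideal n r s \<Longrightarrow> x + y \<in> UR_ideal n r s"
  using additive_subgroup.a_closed[OF ideal.axioms(1)[OF UR_ideal_ideal]] by simp

lemma UR_ideal_left: "a \<in> carrier (free_algebra n) \<Longrightarrow> x \<in> UR_ideal n r s \<Longrightarrow> a * x \<in> UR_ideal n r s"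
  using ideal.I_l_closed[OF UR_ideal_ideal] by simp

lemma UR_ideal_right: "a \<in> carrier (free_algebra n) \<Longrightarrow> x \<in> UR_ideal n r s \<Longrightarrow> x * a \<in> UR_ideal n r s"
  using ideal.I_r_closed[OF UR_ideal_ideal] by simp

text \<open>Working modulo the ideal keeps all computations in the ring of noncommutative polynomials, where
  ordinary sums and products are available; the quotient is entered only at the end.\<close>

definition UR_cong :: "nat \<Rightarrow> complex \<Rightarrow> complex \<Rightarrow> ncpoly \<Rightarrow> ncpoly \<Rightarrow> bool" where
  "UR_cong n r s x y \<longleftrightarrow> x - y \<in> UR_ideal n r s"

lemma UR_cong_refl: "UR_cong n r s x x"
  by (simp add: UR_cong_def UR_ideal_0)

lemma UR_cong_trans [trans]: "UR_cong n r s x y \<Longrightarrow> UR_cong n r s y z \<Longrightarrow> UR_cong n r s x z"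
  using UR_ideal_add[of "x - y" n r s "y - z"] by (simp add: UR_cong_def)

lemma UR_cong_sum: "(\<And>i. i \<in> A \<Longrightarrow> UR_cong n r s (f i) (g i)) \<Longrightarrow> UR_cong n r s (sum f A) (sum g A)"
proof (induction A rule: infinite_finite_induct)
  case (insert i A)
  then have "f i - g i \<in> UR_ideal n r s" "sum f A - sum g A \<in> UR_ideal n r s"
    by (simp_all add: UR_cong_def)
  then show ?case
    unfolding UR_cong_def sum.insert[OF insert.hyps] add_diff_add by (rule UR_ideal_add)
qed (auto simp: UR_cong_refl)

lemma UR_cong_mult:
  assumes "UR_cong n r s x y" and "a \<in> carrier (free_algebra n)" and "b \<in> carrier (free_algebra n)"
  shows "UR_cong n r s (a * x * b) (a * y * b)"
  using UR_ideal_right[OF assms(3) UR_ideal_left[OF assms(2)], of "x - y" r s] assms(1)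
  by (simp add: UR_cong_def left_diff_distrib right_diff_distrib)

lemma RLL_cong:
  assumes "(X, Y) \<in> {(Lp_mat, Lp_mat), (Lm_mat, Lm_mat), (Lp_mat, Lm_mat)}"
    and "a \<in> {1..n}" "i \<in> {1..n}" "b \<in> {1..n}" "j \<in> {1..n}"
  shows "UR_cong n r s (RLL_left r s X Y a i b j) (RLL_right r s X Y a i b j)"
proof -
  have "RLL_left r s X Y a i b j - RLL_right r s X Y a i b j \<in> RLL_relators n r s X Y"
    using assms carrier_Lp_mat carrier_Lm_mat by (subst RLL_relators_entries) blast+
  then show ?thesis
    using assms(1) UR_relators_ideal[of n r s] by (auto simp: UR_cong_def UR_relators_def)
qed

section \<open>Moving a generator matrix through a mixed product\<close>

definition based_words :: "nat \<Rightarrow> (nat \<times> (nat \<Rightarrow> nat)) set" where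
  "based_words n = {1..n} \<times> index_words n"

text \<open>Exchanging the index in the factor \<open>0\<close> with a letter is an involution on the summation set, which is what
  makes the adjoint of \<open>R\<^sub>0\<^sub>i\<close> a mere reindexing.\<close>

lemma exchange_base_word:
  assumes "(a, u) \<in> based_words n" "i \<in> {1..n}"
  shows "(u i, u(i := a)) \<in> based_words n"
  using assms by (auto simp: based_words_def index_words_def)

lemma R_leg_adjoint:
  fixes F :: "nat \<Rightarrow> (nat \<Rightarrow> nat) \<Rightarrow> ncpoly"
  assumes i: "i \<in> {1..n}"
  shows "(\<Sum>(a, u)\<in>based_words n. const (R_leg r s p q key i f a u) * F a u) =
    (\<Sum>(a, u)\<in>based_words n. const (f a u) *
      (const (R_diag s p q key a (u i)) * F a u +
       (if key (u i) < key a then const (s - r) * F (u i) (u(i := a)) else 0)))"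
proof -
  let ?J = "based_words n"
  define A where "A = (\<Sum>(a, u)\<in>?J. const (f a u) * (const (R_diag s p q key a (u i)) * F a u))"
  have "(\<Sum>(a, u)\<in>?J. const (R_leg r s p q key i f a u) * F a u) =
      A + (\<Sum>(a, u)\<in>?J. if key a < key (u i) then const (f (u i) (u(i := a))) * (const (s - r) * F a u) else 0)"
    unfolding A_def sum.distrib[symmetric]
  proof (intro sum.cong refl)
    fix z :: "nat \<times> (nat \<Rightarrow> nat)"
    obtain a u where z: "z = (a, u)" by (cases z)
    have "const (R_leg r s p q key i f a u) * F a u =
      const (f a u) * (const (R_diag s p q key a (u i)) * F a u) +
      (if key a < key (u i) then const (f (u i) (u(i := a))) * (const (s - r) * F a u) else 0)"
      unfolding R_leg_def const_add const_if_mult distrib_right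
      by (simp only: const_mult mult.assoc const_left_commute[of "const (R_diag s p q key a (u i))"]
          const_left_commute[of "const (s - r)"])
    then show "(case z of (a, u) \<Rightarrow> const (R_leg r s p q key i f a u) * F a u) =
      (case z of (a, u) \<Rightarrow> const (f a u) * (const (R_diag s p q key a (u i)) * F a u)) +
      (case z of (a, u) \<Rightarrow>
        if key a < key (u i) then const (f (u i) (u(i := a))) * (const (s - r) * F a u) else 0)"
      unfolding z by (simp only: prod.case)
  qed
  also have "(\<Sum>(a, u)\<in>?J. if key a < key (u i) then const (f (u i) (u(i := a))) * (const (s - r) * F a u) else 0) =
      (\<Sum>(a, u)\<in>?J. if key (u i) < key a then const (f a u) * (const (s - r) * F (u i) (u(i := a))) else 0)"
    by (rule sum.reindex_bij_witness[where i = "\<lambda>(a, u). (u i, u(i := a))" and j = "\<lambda>(a, u). (u i, u(i := a))"])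
      (auto intro: exchange_base_word[OF _ i])
  also have "A + \<dots> = (\<Sum>(a, u)\<in>?J. const (f a u) *
      (const (R_diag s p q key a (u i)) * F a u +
       (if key (u i) < key a then const (s - r) * F (u i) (u(i := a)) else 0)))"
    unfolding A_def sum.distrib[symmetric]
    by (intro sum.cong refl) (simp add: case_prod_beta distrib_left)
  finally show ?thesis .
qed

type_synonym word_matrix = "nat \<Rightarrow> (nat \<Rightarrow> nat) \<Rightarrow> nat \<Rightarrow> (nat \<Rightarrow> nat) \<Rightarrow> ncpoly"

text \<open>The contraction \<open>f H g\<close> of a matrix on \<open>V \<otimes> V\<^sup>\<otimes>\<^sup>n\<close> with algebra entries, for a scalar row vector \<open>f\<close> and a scalar
  column vector \<open>g\<close>.\<close>

definition pairing :: "nat \<Rightarrow> (nat \<Rightarrow> (nat \<Rightarrow> nat) \<Rightarrow> complex) \<Rightarrow> word_matrix \<Rightarrow>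
    (nat \<Rightarrow> (nat \<Rightarrow> nat) \<Rightarrow> complex) \<Rightarrow> ncpoly" where
  "pairing n f H g = (\<Sum>(a, u)\<in>based_words n. const (f a u) *
     (\<Sum>(b, w)\<in>based_words n. const (g b w) * H a u b w))"

text \<open>\<open>R\<^sub>0\<^sub>i H\<close> and \<open>H R\<^sub>0\<^sub>i\<close> for \<open>key = int\<close>, and the same with \<open>R\<^sub>i\<^sub>0\<close> for the reversed key.\<close>

definition exchange_rows :: "complex \<Rightarrow> complex \<Rightarrow> (nat \<Rightarrow> int) \<Rightarrow> nat \<Rightarrow> word_matrix \<Rightarrow> word_matrix" where
  "exchange_rows r s key i H = (\<lambda>a u b w. const (R_diag s (r * s) 1 key a (u i)) * H a u b w +
     (if key a < key (u i) then const (s - r) * H (u i) (u(i := a)) b w else 0))"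

definition exchange_columns :: "complex \<Rightarrow> complex \<Rightarrow> (nat \<Rightarrow> int) \<Rightarrow> nat \<Rightarrow> word_matrix \<Rightarrow> word_matrix" where
  "exchange_columns r s key i H = (\<lambda>a u b w. const (R_diag s (r * s) 1 key b (w i)) * H a u b w +
     (if key (w i) < key b then const (s - r) * H a u (w i) (w(i := b)) else 0))"

text \<open>A scalar matrix next to \<open>f\<close> or \<open>g\<close> can be absorbed into it. On the row side this is the transposed matrix,
  hence the reversed key and the exchanged diagonal entries.\<close>

lemma pairing_exchange_columns:
  assumes "i \<in> {1..n}"
  shows "pairing n f (exchange_columns r s key i H) g = pairing n f H (R_leg r s (r * s) 1 key i g)"
  unfolding pairing_def exchange_columns_def R_leg_adjoint[OF assms] ..

lemma pairing_exchange_rows: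
  assumes "i \<in> {1..n}"
  shows "pairing n f (exchange_rows r s key i H) g = pairing n (R_leg r s 1 (r * s) (\<lambda>x. - key x) i f) H g"
  unfolding pairing_def R_leg_adjoint[OF assms]
proof (intro sum.cong refl)
  fix z :: "nat \<times> (nat \<Rightarrow> nat)"
  obtain a u where z: "z = (a, u)" by (cases z)
  have diag: "R_diag s 1 (r * s) (\<lambda>x. - key x) a (u i) = R_diag s (r * s) 1 key a (u i)"
    by (simp add: R_diag_def)
  let ?S = "\<lambda>H a u. \<Sum>(b, w)\<in>based_words n. const (g b w) * H a u b w"
  have "?S (exchange_rows r s key i H) a u = const (R_diag s (r * s) 1 key a (u i)) * ?S H a u +
      (if key a < key (u i) then const (s - r) * ?S H (u i) (u(i := a)) else 0)"
  proof (cases "key a < key (u i)")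
    case True
    then show ?thesis
      by (simp add: exchange_rows_def sum_distrib_left sum.distrib[symmetric] case_prod_beta distrib_left
          const_left_commute[of "const (g _ _)"])
  next
    case False
    then show ?thesis
      by (simp add: exchange_rows_def sum_distrib_left case_prod_beta const_left_commute[of "const (g _ _)"])
  qed
  then show "(case z of (a, u) \<Rightarrow> const (f a u) * ?S (exchange_rows r s key i H) a u) =
    (case z of (a, u) \<Rightarrow> const (f a u) * (const (R_diag s 1 (r * s) (\<lambda>x. - key x) a (u i)) * ?S H a u +
      (if - key (u i) < - key a then const (s - r) * ?S H (u i) (u(i := a)) else 0)))"
    unfolding z by (simp add: diag)
qed

lemma pairing_cong:
  assumes "\<And>a u b w. (a, u) \<in> based_words n \<Longrightarrow> (b, w) \<in> based_words n \<Longrightarrow>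
    UR_cong n r s (H a u b w) (H' a u b w)"
  shows "UR_cong n r s (pairing n f H g) (pairing n f H' g)"
proof -
  have left: "UR_cong n r s (const c * x) (const c * y)" if "UR_cong n r s x y" for c x y
    using UR_cong_mult[OF that carrier_const carrier_1] by simp
  show ?thesis
    unfolding pairing_def by (intro UR_cong_sum) (auto intro!: left UR_cong_sum assms)
qed

text \<open>If \<open>R\<close> at the position \<open>\<pi> t\<close> intertwines \<open>H t\<close> with \<open>H (Suc t)\<close>, the R-matrices travel one after the other from the row vector to the
  column vector. The matrix that was the last to be applied to \<open>f\<close> is the one next to \<open>H 0\<close>, which is why \<open>f\<close> is swept in
  the reverse order.\<close>

lemma pairing_sweep:
  assumes "\<And>t. t < m \<Longrightarrow> \<pi> t \<in> {1..n}"
    and "\<And>t a u b w. t < m \<Longrightarrow> (a, u) \<in> based_words n \<Longrightarrow> (b, w) \<in> based_words n \<Longrightarrow>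
      UR_cong n r s (exchange_rows r s key (\<pi> t) (H t) a u b w)
        (exchange_columns r s key (\<pi> t) (H (Suc t)) a u b w)"
  shows "UR_cong n r s
    (pairing n (R_sweep r s 1 (r * s) (\<lambda>x. - key x) (rev (map \<pi> [0..<m])) f) (H 0) g)
    (pairing n f (H m) (R_sweep r s (r * s) 1 key (map \<pi> [0..<m]) g))"
  using assms
proof (induction m arbitrary: f)
  case 0
  then show ?case by (simp add: R_sweep_def UR_cong_refl)
next
  case (Suc m)
  let ?f = "R_leg r s 1 (r * s) (\<lambda>x. - key x) (\<pi> m) f"
  let ?g = "R_sweep r s (r * s) 1 key (map \<pi> [0..<m]) g"
  have \<pi>: "\<pi> m \<in> {1..n}" using Suc.prems(1) by simp
  have "UR_cong n r s
      (pairing n (R_sweep r s 1 (r * s) (\<lambda>x. - key x) (rev (map \<pi> [0..<m])) ?f) (H 0) g)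
      (pairing n ?f (H m) ?g)"
    using Suc.prems by (intro Suc.IH) simp_all
  also have "pairing n ?f (H m) ?g = pairing n f (exchange_rows r s key (\<pi> m) (H m)) ?g"
    by (rule pairing_exchange_rows[OF \<pi>, symmetric])
  also have "UR_cong n r s \<dots> (pairing n f (exchange_columns r s key (\<pi> m) (H (Suc m))) ?g)"
    using Suc.prems(2) by (intro pairing_cong) simp
  also have "pairing n f (exchange_columns r s key (\<pi> m) (H (Suc m))) ?g =
      pairing n f (H (Suc m)) (R_leg r s (r * s) 1 key (\<pi> m) ?g)"
    by (rule pairing_exchange_columns[OF \<pi>])
  finally show ?case by (simp add: R_sweep_def)
qed

text \<open>The factor at position \<open>i\<close> of the mixed product, between the letters of \<open>u\<close> and of \<open>w\<close> at this position.\<close>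

definition mixed_entry :: "nat \<Rightarrow> (nat \<Rightarrow> nat) \<Rightarrow> (nat \<Rightarrow> nat) \<Rightarrow> nat \<Rightarrow> ncpoly" where
  "mixed_entry k u w i = (if i \<le> k then Lp_mat (u i) (w i) else Lm_mat (u i) (w i))"

text \<open>The mixed product with the matrix \<open>L\<close>, which acts on the factor \<open>0\<close>, inserted after the first \<open>t\<close> factors.\<close>

definition inserted :: "nat \<Rightarrow> nat \<Rightarrow> (nat \<Rightarrow> nat \<Rightarrow> ncpoly) \<Rightarrow> nat \<Rightarrow> word_matrix" where
  "inserted n k L t = (\<lambda>a u b w. prod_list (map (mixed_entry k u w) [1..<Suc t]) * L a b *
     prod_list (map (mixed_entry k u w) [Suc t..<Suc n]))"

lemma carrier_mixed_entry:
  assumes "u \<in> index_words n" "w \<in> index_words n" "i \<in> {1..n}"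
  shows "mixed_entry k u w i \<in> carrier (free_algebra n)"
proof -
  have "u i \<in> {1..n}" "w i \<in> {1..n}" using assms unfolding index_words_def by blast+
  then show ?thesis by (simp add: mixed_entry_def carrier_Lp_mat carrier_Lm_mat del: atLeastAtMost_iff)
qed

lemma inserted_factor:
  fixes k :: nat
  assumes "t < n"
  defines "P \<equiv> \<lambda>u w. prod_list (map (mixed_entry k u w) [1..<Suc t])"
    and "Q \<equiv> \<lambda>u w. prod_list (map (mixed_entry k u w) [Suc (Suc t)..<Suc n])"
  shows "inserted n k L t a u b w = P u w * (L a b * mixed_entry k u w (Suc t)) * Q u w"
    and "inserted n k L (Suc t) a u b w = P u w * (mixed_entry k u w (Suc t) * L a b) * Q u w"
proof -
  have "[Suc t..<Suc n] = Suc t # [Suc (Suc t)..<Suc n]" using assms(1) by (simp add: upt_conv_Cons)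
  then show "inserted n k L t a u b w = P u w * (L a b * mixed_entry k u w (Suc t)) * Q u w"
    by (simp add: inserted_def P_def Q_def mult.assoc del: upt_Suc)
  have "[1..<Suc (Suc t)] = [1..<Suc t] @ [Suc t]" by simp
  then show "inserted n k L (Suc t) a u b w = P u w * (mixed_entry k u w (Suc t) * L a b) * Q u w"
    unfolding inserted_def P_def Q_def by (simp only: map_append list.map prod_list.append prod_list.Cons prod_list.Nil mult_1_right mult.assoc)
qed

lemma flank_update:
  assumes "i \<in> {1..n}"
  shows "prod_list (map (mixed_entry k (u(i := a)) w) [1..<i]) = prod_list (map (mixed_entry k u w) [1..<i])"
    "prod_list (map (mixed_entry k u (w(i := a))) [1..<i]) = prod_list (map (mixed_entry k u w) [1..<i])"
    "prod_list (map (mixed_entry k (u(i := a)) w) [Suc i..<Suc n]) = prod_list (map (mixed_entry k u w) [Suc i..<Suc n])"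
    "prod_list (map (mixed_entry k u (w(i := a))) [Suc i..<Suc n]) = prod_list (map (mixed_entry k u w) [Suc i..<Suc n])"
  by (auto intro!: arg_cong[of _ _ prod_list] simp: mixed_entry_def simp del: upt_Suc)

text \<open>Whichever of the two matrices stands at position \<open>i\<close>, the pairs with \<open>L\<^sup>+\<close> on the left and with \<open>L\<^sup>-\<close> on the right are
  among those for which there is a defining relation. The pair \<open>(L\<^sup>-, L\<^sup>+)\<close>, for which there is none, never occurs.\<close>

lemma RLL_pair_mixed:
  assumes "i \<in> {1..n}"
  obtains X where "(Lp_mat, X) \<in> {(Lp_mat, Lp_mat), (Lm_mat, Lm_mat), (Lp_mat, Lm_mat)}"
    "(X, Lm_mat) \<in> {(Lp_mat, Lp_mat), (Lm_mat, Lm_mat), (Lp_mat, Lm_mat)}"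
    "\<And>u w. mixed_entry k u w i = X (u i) (w i)"
proof
  show "(Lp_mat, if i \<le> k then Lp_mat else Lm_mat) \<in> {(Lp_mat, Lp_mat), (Lm_mat, Lm_mat), (Lp_mat, Lm_mat)}"
    "(if i \<le> k then Lp_mat else Lm_mat, Lm_mat) \<in> {(Lp_mat, Lp_mat), (Lm_mat, Lm_mat), (Lp_mat, Lm_mat)}"
    "\<And>u w. mixed_entry k u w i = (if i \<le> k then Lp_mat else Lm_mat) (u i) (w i)"
    by (simp_all add: mixed_entry_def)
qed

text \<open>Moving \<open>L\<^sup>+\<close> to the right, or \<open>L\<^sup>-\<close> to the left, past one factor is one defining relation multiplied by the unaffected
  factors \<open>P\<close> and \<open>Q\<close> on the two sides. For \<open>L\<^sup>-\<close> the inserted matrix is the second one in the relation, so the factor \<open>0\<close> is the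
  second leg of \<open>R\<close>.\<close>

lemma exchange_inserted:
  assumes t: "t < n" and word: "(a, u) \<in> based_words n" "(b, w) \<in> based_words n"
  shows "UR_cong n r s (exchange_rows r s int (Suc t) (inserted n k Lp_mat t) a u b w)
      (exchange_columns r s int (Suc t) (inserted n k Lp_mat (Suc t)) a u b w)" (is ?plus)
    and "UR_cong n r s (exchange_rows r s (\<lambda>x. - int x) (Suc t) (inserted n k Lm_mat (Suc t)) a u b w)
      (exchange_columns r s (\<lambda>x. - int x) (Suc t) (inserted n k Lm_mat t) a u b w)" (is ?minus)
proof -
  let ?i = "Suc t"
  define P where "P = prod_list (map (mixed_entry k u w) [1..<?i])"
  define Q where "Q = prod_list (map (mixed_entry k u w) [Suc ?i..<Suc n])"
  have i: "?i \<in> {1..n}" using t by simp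
  obtain X where X: "(Lp_mat, X) \<in> {(Lp_mat, Lp_mat), (Lm_mat, Lm_mat), (Lp_mat, Lm_mat)}"
      "(X, Lm_mat) \<in> {(Lp_mat, Lp_mat), (Lm_mat, Lm_mat), (Lp_mat, Lm_mat)}"
      "\<And>u w. mixed_entry k u w ?i = X (u ?i) (w ?i)"
    using RLL_pair_mixed[OF i] by metis
  have range: "a \<in> {1..n}" "b \<in> {1..n}" "u \<in> index_words n" "w \<in> index_words n"
    using word by (auto simp: based_words_def)
  then have range': "u ?i \<in> {1..n}" "w ?i \<in> {1..n}" using i unfolding index_words_def by blast+
  have PQ: "P \<in> carrier (free_algebra n)" "Q \<in> carrier (free_algebra n)"
    unfolding P_def Q_def using range(3,4) t
    by (auto intro!: carrier_prod_list carrier_mixed_entry simp del: upt_Suc)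
  note factor = inserted_factor[OF t] flank_update[OF i] X(3) P_def[symmetric] Q_def[symmetric]
    fun_upd_same
  have distrib: "const c * (P * x * Q) + (if B then const d * (P * y * Q) else 0) =
      P * (const c * x + (if B then const d * y else 0)) * Q" for c d x y B
  proof -
    have move: "const c * (P * x * Q) = P * (const c * x) * Q" for c x
      by (simp only: mult.assoc const_left_commute)
    show ?thesis by (simp add: move distrib_left distrib_right)
  qed
  have diag: "R_diag s (r * s) 1 (\<lambda>x. - int x) x y = R_diag s (r * s) 1 int y x" for x y
    by (simp add: R_diag_def)
  have neg: "- int x < - int y \<longleftrightarrow> y < x" for x y by simp
  have "exchange_rows r s int ?i (inserted n k Lp_mat t) a u b w = P * RLL_left r s Lp_mat X a (u ?i) b (w ?i) * Q"
    unfolding exchange_rows_def factor distrib RLL_left_def of_nat_less_iff ..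
  moreover have "exchange_columns r s int ?i (inserted n k Lp_mat ?i) a u b w =
      P * RLL_right r s Lp_mat X a (u ?i) b (w ?i) * Q"
    unfolding exchange_columns_def factor distrib RLL_right_def of_nat_less_iff ..
  ultimately show ?plus
    using UR_cong_mult[OF RLL_cong[OF X(1) range(1) range'(1) range(2) range'(2)] PQ] by simp
  have "exchange_rows r s (\<lambda>x. - int x) ?i (inserted n k Lm_mat ?i) a u b w =
      P * RLL_left r s X Lm_mat (u ?i) a (w ?i) b * Q"
    unfolding exchange_rows_def factor distrib RLL_left_def neg diag ..
  moreover have "exchange_columns r s (\<lambda>x. - int x) ?i (inserted n k Lm_mat t) a u b w =
      P * RLL_right r s X Lm_mat (u ?i) a (w ?i) b * Q"
    unfolding exchange_columns_def factor distrib RLL_right_def neg diag ..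
  ultimately show ?minus
    using UR_cong_mult[OF RLL_cong[OF X(2) range'(1) range(1) range'(2) range(2)] PQ] by simp
qed

text \<open>A representative of \<open>c\<^sub>k\<close> in the free algebra. The sums run over all words, the non-permutations having
  coefficient \<open>0\<close>.\<close>

definition c_poly :: "nat \<Rightarrow> complex \<Rightarrow> complex \<Rightarrow> nat \<Rightarrow> ncpoly" where
  "c_poly n r s k = (\<Sum>u\<in>index_words n. const (antisymmetrizer (- 1 / s) n u) *
     (\<Sum>w\<in>index_words n. const (antisymmetrizer (- r) n w) * prod_list (map (mixed_entry k u w) [1..<Suc n])))"

lemma sum_based:
  assumes "a \<in> {1..n}"
  shows "(\<Sum>(a', u)\<in>based_words n. const (based a v a' u) * F a' u) =
    (\<Sum>u\<in>index_words n. const (v u) * F a u)"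
proof -
  have "(\<Sum>(a', u)\<in>based_words n. const (based a v a' u) * F a' u) =
      (\<Sum>a'\<in>{1..n}. if a' = a then (\<Sum>u\<in>index_words n. const (v u) * F a u) else 0)"
    unfolding based_words_def sum.cartesian_product[symmetric]
    by (intro sum.cong refl) (auto simp: based_def)
  then show ?thesis using assms by simp
qed

lemma pairing_based:
  assumes "a \<in> {1..n}" "b \<in> {1..n}"
  shows "pairing n (based a (antisymmetrizer (- 1 / s) n)) (inserted n k L 0) (based b (antisymmetrizer (- r) n)) =
      L a b * c_poly n r s k"
    and "pairing n (based a (antisymmetrizer (- 1 / s) n)) (inserted n k L n) (based b (antisymmetrizer (- r) n)) =
      c_poly n r s k * L a b"
proof -
  have "inserted n k L 0 a u b w = L a b * prod_list (map (mixed_entry k u w) [1..<Suc n])" for u w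
    by (simp add: inserted_def del: upt_Suc)
  then show "pairing n (based a (antisymmetrizer (- 1 / s) n)) (inserted n k L 0) (based b (antisymmetrizer (- r) n)) =
      L a b * c_poly n r s k"
    unfolding pairing_def sum_based[OF assms(1)] sum_based[OF assms(2)]
    by (simp add: c_poly_def sum_distrib_left
        const_left_commute[of "L a b"] del: upt_Suc)
  have "inserted n k L n a u b w = prod_list (map (mixed_entry k u w) [1..<Suc n]) * L a b" for u w
    by (simp add: inserted_def del: upt_Suc)
  then show "pairing n (based a (antisymmetrizer (- 1 / s) n)) (inserted n k L n) (based b (antisymmetrizer (- r) n)) =
      c_poly n r s k * L a b"
    unfolding pairing_def sum_based[OF assms(1)] sum_based[OF assms(2)]
    by (simp add: c_poly_def sum_distrib_left
        sum_distrib_right mult.assoc del: upt_Suc)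
qed

lemma pairing_scale_left:
  assumes "\<And>a u. (a, u) \<in> based_words n \<Longrightarrow> f a u = d * f' a u"
  shows "pairing n f H g = const d * pairing n f' H g"
  unfolding pairing_def sum_distrib_left
  by (intro sum.cong refl) (auto simp: assms const_mult sum_distrib_left mult.assoc)

lemma pairing_scale_right:
  assumes "\<And>b w. (b, w) \<in> based_words n \<Longrightarrow> g b w = d * g' b w"
  shows "pairing n f H g = const d * pairing n f H g'"
proof -
  have inner: "(\<Sum>(b, w)\<in>based_words n. const (g b w) * H a u b w) =
      const d * (\<Sum>(b, w)\<in>based_words n. const (g' b w) * H a u b w)" for a u
    unfolding sum_distrib_left by (intro sum.cong refl) (auto simp: assms const_mult mult.assoc)
  show ?thesis
    unfolding pairing_def inner
    by (simp add: sum_distrib_left case_prod_beta const_left_commute[of "const (f _ _)"])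
qed

text \<open>The contraction of \<open>(R\<^sub>0\<^sub>n \<dots> R\<^sub>0\<^sub>1) L\<^sup>+\<^sub>0 T = T L\<^sup>+\<^sub>0 (R\<^sub>0\<^sub>n \<dots> R\<^sub>0\<^sub>1)\<close> with \<open>e\<^sub>a\<^sup>* \<otimes> \<alpha>\<close> and \<open>e\<^sub>b \<otimes> \<beta>\<close>. Rows are swept downwards
  with \<open>p = 1\<close>, \<open>q = r s\<close>, and columns upwards with \<open>p = r s\<close>, \<open>q = 1\<close>; the eigenvalues agree.\<close>

lemma Lp_c_poly_commute:
  assumes s: "s \<noteq> 0" and r: "r \<noteq> 0" and a: "a \<in> {1..n}" and b: "b \<in> {1..n}"
  shows "UR_cong n r s (const (s * (r * s) ^ (n - a)) * (Lp_mat a b * c_poly n r s k))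
    (const (s * (r * s) ^ (n - b)) * (c_poly n r s k * Lp_mat a b))"
proof -
  let ?f = "based a (antisymmetrizer (- 1 / s) n)" and ?g = "based b (antisymmetrizer (- r) n)"
  have positions: "map Suc [0..<n] = [1..<Suc n]" by (simp only: map_Suc_upt One_nat_def)
  have words: "u \<in> index_words n" if "(c, u) \<in> based_words n" for c u
    using that by (simp add: based_words_def)
  have "UR_cong n r s
      (pairing n (R_sweep r s 1 (r * s) (\<lambda>x. - int x) (rev (map Suc [0..<n])) ?f) (inserted n k Lp_mat 0) ?g)
      (pairing n ?f (inserted n k Lp_mat n) (R_sweep r s (r * s) 1 int (map Suc [0..<n]) ?g))"
    by (rule pairing_sweep[where H = "inserted n k Lp_mat"]) (auto intro: exchange_inserted(1))
  moreover have "pairing n (R_sweep r s 1 (r * s) (\<lambda>x. - int x) (rev (map Suc [0..<n])) ?f) (inserted n k Lp_mat 0) ?g =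
      const (s * (r * s) ^ (n - a)) * pairing n ?f (inserted n k Lp_mat 0) ?g"
    unfolding positions
    by (rule pairing_scale_left) (subst R_sweep_antisymmetrizer_down; simp add: s a[simplified] words)
  moreover have "pairing n ?f (inserted n k Lp_mat n) (R_sweep r s (r * s) 1 int (map Suc [0..<n]) ?g) =
      const (s * (r * s) ^ (n - b)) * pairing n ?f (inserted n k Lp_mat n) ?g"
    unfolding positions
    by (rule pairing_scale_right) (subst R_sweep_antisymmetrizer_up; simp add: r b[simplified] words)
  ultimately show ?thesis by (simp only: pairing_based[OF a b])
qed

text \<open>The contraction of \<open>(R\<^sub>1\<^sub>0 \<dots> R\<^sub>n\<^sub>0) T L\<^sup>-\<^sub>0 = L\<^sup>-\<^sub>0 T (R\<^sub>1\<^sub>0 \<dots> R\<^sub>n\<^sub>0)\<close>. Now \<open>L\<^sup>-\<close> starts behind all factors, and the sweeps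
  run in the opposite directions.\<close>

lemma Lm_c_poly_commute:
  assumes s: "s \<noteq> 0" and r: "r \<noteq> 0" and a: "a \<in> {1..n}" and b: "b \<in> {1..n}"
  shows "UR_cong n r s (const (s * (r * s) ^ (a - 1)) * (c_poly n r s k * Lm_mat a b))
    (const (s * (r * s) ^ (b - 1)) * (Lm_mat a b * c_poly n r s k))"
proof -
  let ?f = "based a (antisymmetrizer (- 1 / s) n)" and ?g = "based b (antisymmetrizer (- r) n)"
  \<comment> \<open>The generator matrix starts after the last factor and moves left, so its position after \<open>t\<close> steps is \<open>n - t\<close>.\<close>
  let ?H = "\<lambda>t. inserted n k Lm_mat (n - t)"
  have positions: "map (\<lambda>t. n - t) [0..<n] = rev [1..<Suc n]"
    by (rule nth_equalityI) (simp_all add: rev_nth del: upt_Suc)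
  have words: "u \<in> index_words n" if "(c, u) \<in> based_words n" for c u
    using that by (simp add: based_words_def)
  have "UR_cong n r s
      (pairing n (R_sweep r s 1 (r * s) (\<lambda>x. - (- int x)) (rev (map (\<lambda>t. n - t) [0..<n])) ?f) (?H 0) ?g)
      (pairing n ?f (?H n) (R_sweep r s (r * s) 1 (\<lambda>x. - int x) (map (\<lambda>t. n - t) [0..<n]) ?g))"
  proof (rule pairing_sweep[where H = ?H])
    fix t a u b w assume t: "t < n" and word: "(a, u) \<in> based_words n" "(b, w) \<in> based_words n"
    then have "n - t = Suc (n - Suc t)" by simp
    then show "UR_cong n r s (exchange_rows r s (\<lambda>x. - int x) (n - t) (?H t) a u b w)
        (exchange_columns r s (\<lambda>x. - int x) (n - t) (?H (Suc t)) a u b w)"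
      using exchange_inserted(2)[OF _ word, of "n - Suc t" r s k] t by simp
  qed auto
  moreover have "pairing n (R_sweep r s 1 (r * s) (\<lambda>x. - (- int x)) (rev (map (\<lambda>t. n - t) [0..<n])) ?f) (?H 0) ?g =
      const (s * (r * s) ^ (a - 1)) * pairing n ?f (inserted n k Lm_mat n) ?g"
    unfolding positions minus_minus rev_rev_ident diff_zero
    by (rule pairing_scale_left) (subst R_sweep_antisymmetrizer_up; simp add: s a[simplified] words)
  moreover have "pairing n ?f (?H n) (R_sweep r s (r * s) 1 (\<lambda>x. - int x) (map (\<lambda>t. n - t) [0..<n]) ?g) =
      const (s * (r * s) ^ (b - 1)) * pairing n ?f (inserted n k Lm_mat 0) ?g"
    unfolding positions diff_self_eq_0
    by (rule pairing_scale_right) (subst R_sweep_antisymmetrizer_down; simp add: r b[simplified] words)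
  ultimately show ?thesis by (simp only: pairing_based[OF a b])
qed

section \<open>Passage to the quotient algebra\<close>

lemma UR_class_hom: "UR_class n r s \<in> ring_hom (free_algebra n) (UR n r s)"
  using ideal.rcos_ring_hom[OF UR_ideal_ideal] unfolding UR_class_def UR_def .

lemma UR_class_closed: "x \<in> carrier (free_algebra n) \<Longrightarrow> UR_class n r s x \<in> carrier (UR n r s)"
  by (rule ring_hom_closed[OF UR_class_hom])

lemma UR_class_mult:
  "x \<in> carrier (free_algebra n) \<Longrightarrow> y \<in> carrier (free_algebra n) \<Longrightarrow>
    UR_class n r s (x * y) = UR_class n r s x \<otimes>\<^bsub>UR n r s\<^esub> UR_class n r s y"
  using ring_hom_mult[OF UR_class_hom, of x n y] by simp

lemma UR_class_add:
  "x \<in> carrier (free_algebra n) \<Longrightarrow> y \<in> carrier (free_algebra n) \<Longrightarrow>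
    UR_class n r s (x + y) = UR_class n r s x \<oplus>\<^bsub>UR n r s\<^esub> UR_class n r s y"
  using ring_hom_add[OF UR_class_hom, of x n y] by simp

lemma UR_class_one: "UR_class n r s 1 = \<one>\<^bsub>UR n r s\<^esub>"
  using ring_hom_one[OF UR_class_hom] by simp

lemma UR_class_zero: "UR_class n r s 0 = \<zero>\<^bsub>UR n r s\<^esub>"
  using ring_hom_zero[OF UR_class_hom free_algebra_ring UR_ring] by simp

lemma UR_class_eq:
  assumes "UR_cong n r s x y" "x \<in> carrier (free_algebra n)" "y \<in> carrier (free_algebra n)"
  shows "UR_class n r s x = UR_class n r s y"
proof -
  interpret ring "free_algebra n" by (rule free_algebra_ring)
  interpret U: ring "UR n r s" by (rule UR_ring)
  have "UR_class n r s (x - y) = \<zero>\<^bsub>UR n r s\<^esub>"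
    using abelian_subgroup.a_rcos_const[OF abelian_subgroupI3[OF ideal.axioms(1)[OF UR_ideal_ideal] is_abelian_group]]
      assms(1) by (simp add: UR_cong_def UR_class_def UR_def FactRing_def)
  moreover have "UR_class n r s x = UR_class n r s (x - y) \<oplus>\<^bsub>UR n r s\<^esub> UR_class n r s y"
    using UR_class_add[of "x - y" n y r s] assms carrier_diff by simp
  ultimately show ?thesis using UR_class_closed[OF assms(3)] by simp
qed

lemma UR_class_sum:
  assumes "finite A" and "\<And>i. i \<in> A \<Longrightarrow> f i \<in> carrier (free_algebra n)"
  shows "finsum (UR n r s) (\<lambda>i. UR_class n r s (f i)) A = UR_class n r s (sum f A)"
proof -
  interpret U: ring "UR n r s" by (rule UR_ring)
  show ?thesis
    using assms
    by (induction A rule: finite_induct)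
      (simp_all add: UR_class_zero UR_class_add carrier_sum Pi_def UR_class_closed)
qed

lemma UR_class_prod_list:
  assumes "\<And>x. x \<in> set xs \<Longrightarrow> x \<in> carrier (free_algebra n)"
  shows "UR_prod_list n r s (map (UR_class n r s) xs) = UR_class n r s (prod_list xs)"
  using assms
  by (induction xs) (simp_all add: UR_prod_list_def UR_class_one UR_class_mult carrier_prod_list)

lemma UR_smult_class:
  "x \<in> carrier (free_algebra n) \<Longrightarrow> UR_smult n r s z (UR_class n r s x) = UR_class n r s (const z * x)"
  by (simp add: UR_smult_def UR_scalar_def UR_class_mult carrier_const)

lemma UR_class_mat_mult:
  assumes i: "i \<in> {1..n}" and j: "j \<in> {1..n}"
    and X: "\<And>k. k \<in> {1..n} \<Longrightarrow> X i k = UR_class n r s (X' k) \<and> X' k \<in> carrier (free_algebra n)"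
    and Y: "\<And>k. k \<in> {1..n} \<Longrightarrow> Y k j = UR_class n r s (Y' k) \<and> Y' k \<in> carrier (free_algebra n)"
  shows "UR_mat_mult n r s X Y i j = UR_class n r s (\<Sum>k\<in>{1..n}. X' k * Y' k)"
proof -
  interpret U: ring "UR n r s" by (rule UR_ring)
  have "UR_mat_mult n r s X Y i j = finsum (UR n r s) (\<lambda>k. UR_class n r s (X' k * Y' k)) {1..n}"
    unfolding UR_mat_mult_def mat_mult_def using X Y
    by (intro U.finsum_cong') (simp_all add: UR_class_mult UR_class_closed carrier_mult)
  also have "\<dots> = UR_class n r s (\<Sum>k\<in>{1..n}. X' k * Y' k)"
    using X Y by (intro UR_class_sum) (simp_all add: carrier_mult)
  finally show ?thesis .
qed

lemma UR_diag_class: "UR_diag n r s d i j = UR_class n r s (if i = j then const (d i) else 0)"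
  by (simp add: UR_diag_def UR_scalar_def UR_class_zero)

lemma UR_diag_conjugate:
  assumes i: "i \<in> {1..n}" and j: "j \<in> {1..n}"
    and X: "\<And>i j. i \<in> {1..n} \<Longrightarrow> j \<in> {1..n} \<Longrightarrow> X i j \<in> carrier (free_algebra n)"
  shows "UR_mat_mult n r s (UR_mat_mult n r s (UR_diag n r s d) (\<lambda>i j. UR_class n r s (X i j)))
      (UR_diag n r s d') i j = UR_class n r s (const (d i * d' j) * X i j)"
proof -
  have closed: "(if P then const z else 0) \<in> carrier (free_algebra n)" for P z
    by (simp add: carrier_const carrier_0)
  have left: "UR_mat_mult n r s (UR_diag n r s d) (\<lambda>i j. UR_class n r s (X i j)) i m =
      UR_class n r s (const (d i) * X i m)" if m: "m \<in> {1..n}" for m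
  proof -
    have "UR_mat_mult n r s (UR_diag n r s d) (\<lambda>i j. UR_class n r s (X i j)) i m =
        UR_class n r s (\<Sum>l\<in>{1..n}. (if i = l then const (d i) else 0) * X l m)"
      using X m by (intro UR_class_mat_mult[OF i m]) (simp_all only: UR_diag_class closed)
    also have "(\<Sum>l\<in>{1..n}. (if i = l then const (d i) else 0) * X l m) =
        (\<Sum>l\<in>{1..n}. if l = i then const (d i) * X i m else 0)"
      by (intro sum.cong) auto
    finally show ?thesis using i by simp
  qed
  have "UR_mat_mult n r s (UR_mat_mult n r s (UR_diag n r s d) (\<lambda>i j. UR_class n r s (X i j)))
      (UR_diag n r s d') i j =
      UR_class n r s (\<Sum>m\<in>{1..n}. (const (d i) * X i m) * (if m = j then const (d' m) else 0))"
    using X i by (intro UR_class_mat_mult[OF i j]) (simp_all only: left UR_diag_class closed carrier_mult carrier_const)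
  also have "(\<Sum>m\<in>{1..n}. (const (d i) * X i m) * (if m = j then const (d' m) else 0)) =
      (\<Sum>m\<in>{1..n}. if m = j then const (d i * d' j) * X i j else 0)"
  proof (intro sum.cong refl)
    fix m
    show "(const (d i) * X i m) * (if m = j then const (d' m) else 0) =
        (if m = j then const (d i * d' j) * X i j else 0)"
      using const_commute[of "const (d i) * X i j" "d' j"]
      by (simp add: const_mult mult.assoc[symmetric] const_commute[of "const (d i)" "d' j"])
  qed
  finally show ?thesis using j by simp
qed

lemma carrier_c_poly: "c_poly n r s k \<in> carrier (free_algebra n)"
  unfolding c_poly_def
  by (auto intro!: carrier_sum carrier_mult carrier_const carrier_prod_list carrier_mixed_entry simp del: upt_Suc)

text \<open>The weight \<open>(-s)\<^bsup>-l(\<sigma>)\<^esup>\<close> is the power \<open>(-1/s)\<^bsup>l(\<sigma>)\<^esup>\<close>, so the weights are products of two antisymmetrizer coefficients.\<close>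

lemma c_elem_class:
  assumes "k \<le> n"
  shows "c_elem n r s k = UR_class n r s (c_poly n r s k)"
proof -
  let ?S = "{\<sigma>. \<sigma> permutes {1..n}}"
  define T where "T = (\<lambda>u w. prod_list (map (mixed_entry k u w) [1..<Suc n]))"
  define z where "z = (\<lambda>\<sigma> \<sigma>'. antisymmetrizer (- 1 / s) n \<sigma> * antisymmetrizer (- r) n \<sigma>')"
  have fin: "finite ?S" by (simp add: finite_permutations)
  have T: "T u w \<in> carrier (free_algebra n)" if "u \<in> index_words n" "w \<in> index_words n" for u w
    unfolding T_def using that by (auto intro!: carrier_prod_list carrier_mixed_entry simp del: upt_Suc)
  interpret U: ring "UR n r s" by (rule UR_ring)
  have summand: "UR_smult n r s ((- s) powi (- int (inversions n \<sigma>)) * (- r) ^ inversions n \<sigma>')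
      (UR_prod_list n r s (map (\<lambda>i. l_plus n r s (\<sigma> i) (\<sigma>' i)) [1..<Suc k] @
        map (\<lambda>i. l_minus n r s (\<sigma> i) (\<sigma>' i)) [Suc k..<Suc n])) =
      UR_class n r s (const (z \<sigma> \<sigma>') * T \<sigma> \<sigma>')"
    if \<sigma>: "\<sigma> permutes {1..n}" "\<sigma>' permutes {1..n}" for \<sigma> \<sigma>'
  proof -
    have "[1..<Suc n] = [1..<Suc k] @ [Suc k..<Suc n]"
      using assms upt_add_eq_append[of 1 "Suc k" "n - k"] by simp
    then have "map (\<lambda>i. l_plus n r s (\<sigma> i) (\<sigma>' i)) [1..<Suc k] @
        map (\<lambda>i. l_minus n r s (\<sigma> i) (\<sigma>' i)) [Suc k..<Suc n] =
        map (UR_class n r s) (map (mixed_entry k \<sigma> \<sigma>') [1..<Suc n])"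
      by (simp add: mixed_entry_def l_plus_def l_minus_def del: upt_Suc)
    moreover have "UR_prod_list n r s (map (UR_class n r s) (map (mixed_entry k \<sigma> \<sigma>') [1..<Suc n])) =
        UR_class n r s (T \<sigma> \<sigma>')"
      unfolding T_def using \<sigma> permutes_index_words
      by (intro UR_class_prod_list) (auto intro!: carrier_mixed_entry simp del: upt_Suc)
    moreover have "(- s) powi (- int (inversions n \<sigma>)) * (- r) ^ inversions n \<sigma>' = z \<sigma> \<sigma>'"
    proof -
      have inv: "- 1 / s = inverse (- s)" by (simp add: divide_inverse)
      have "(- s) powi (- int m) = (- 1 / s) ^ m" for m
        unfolding inv power_int_minus power_int_of_nat power_inverse ..
      then show ?thesis using \<sigma> by (simp only: z_def antisymmetrizer_def if_True)
    qed
    ultimately show ?thesis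
      using T[OF permutes_index_words[OF \<sigma>(1)] permutes_index_words[OF \<sigma>(2)]]
      by (simp only: UR_smult_class)
  qed
  have "c_elem n r s k = finsum (UR n r s) (\<lambda>(\<sigma>, \<sigma>'). UR_class n r s (const (z \<sigma> \<sigma>') * T \<sigma> \<sigma>')) (?S \<times> ?S)"
    unfolding c_elem_def
    by (intro U.finsum_cong') (auto simp only: summand permutes_index_words mem_Collect_eq
        intro!: UR_class_closed carrier_mult carrier_const T)
  also have "\<dots> = finsum (UR n r s) (\<lambda>p. UR_class n r s (const (z (fst p) (snd p)) * T (fst p) (snd p))) (?S \<times> ?S)"
    by (simp only: case_prod_beta')
  also have "\<dots> = UR_class n r s (\<Sum>p\<in>?S \<times> ?S. const (z (fst p) (snd p)) * T (fst p) (snd p))"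
    by (intro UR_class_sum) (auto simp: permutes_index_words intro!: carrier_mult carrier_const T finite_cartesian_product fin
        simp del: One_nat_def)
  also have "(\<Sum>p\<in>?S \<times> ?S. const (z (fst p) (snd p)) * T (fst p) (snd p)) =
      (\<Sum>\<sigma>\<in>?S. \<Sum>\<sigma>'\<in>?S. const (z \<sigma> \<sigma>') * T \<sigma> \<sigma>')"
    by (simp add: sum.cartesian_product case_prod_beta')
  also have "\<dots> = (\<Sum>\<sigma>\<in>?S. \<Sum>\<sigma>'\<in>index_words n. const (z \<sigma> \<sigma>') * T \<sigma> \<sigma>')"
    by (intro sum.cong refl sum.mono_neutral_left)
      (auto simp: finite_index_words permutes_index_words z_def antisymmetrizer_def)
  also have "\<dots> = (\<Sum>\<sigma>\<in>index_words n. \<Sum>\<sigma>'\<in>index_words n. const (z \<sigma> \<sigma>') * T \<sigma> \<sigma>')"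
    by (intro sum.mono_neutral_left)
      (auto simp: finite_index_words permutes_index_words z_def antisymmetrizer_def)
  also have "\<dots> = c_poly n r s k"
    by (simp add: c_poly_def z_def T_def const_mult mult.assoc sum_distrib_left del: upt_Suc)
  finally show ?thesis .
qed

lemma UR_cong_cancel:
  assumes "UR_cong n r s (const x * p) (const y * q)" and "x \<noteq> 0"
  shows "UR_cong n r s p (const (inverse x * y) * q)"
  using UR_cong_mult[OF assms(1) carrier_const[of "inverse x"] carrier_1] assms(2)
  by (simp add: mult.assoc[symmetric] const_mult[symmetric])

lemma l_plus_c_elem:
  assumes "r \<noteq> 0" "s \<noteq> 0" "k \<le> n" and i: "i \<in> {1..n}" and j: "j \<in> {1..n}"
  defines "z \<equiv> inverse (M_entry n r s i) * M_entry n r s j"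
  shows "l_plus n r s i j \<otimes>\<^bsub>UR n r s\<^esub> c_elem n r s k =
    UR_class n r s (const z * (c_poly n r s k * Lp_mat i j))"
proof -
  have "UR_cong n r s (Lp_mat i j * c_poly n r s k)
      (const (inverse (s * (r * s) ^ (n - i)) * (s * (r * s) ^ (n - j))) *
        (c_poly n r s k * Lp_mat i j))"
    using Lp_c_poly_commute[OF assms(2,1) i j] by (rule UR_cong_cancel) (simp add: assms)
  moreover have "inverse (s * (r * s) ^ (n - i)) * (s * (r * s) ^ (n - j)) = z"
    using assms(1,2) by (simp add: z_def M_entry_def field_simps)
  ultimately have "UR_cong n r s (Lp_mat i j * c_poly n r s k) (const z * (c_poly n r s k * Lp_mat i j))"
    by (simp only:)
  then show ?thesis
    using UR_class_eq[of n r s "Lp_mat i j * c_poly n r s k" "const z * (c_poly n r s k * Lp_mat i j)"]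
      carrier_Lp_mat[OF i j] carrier_c_poly[of n r s k] carrier_const
    by (simp add: l_plus_def c_elem_class[OF assms(3)] UR_class_mult[symmetric] carrier_mult)
qed

lemma c_elem_l_minus:
  assumes "r \<noteq> 0" "s \<noteq> 0" "k \<le> n" and i: "i \<in> {1..n}" and j: "j \<in> {1..n}"
  defines "z \<equiv> inverse (M'_entry r s i) * M'_entry r s j"
  shows "c_elem n r s k \<otimes>\<^bsub>UR n r s\<^esub> l_minus n r s i j =
    UR_class n r s (const z * (Lm_mat i j * c_poly n r s k))"
proof -
  have "UR_cong n r s (c_poly n r s k * Lm_mat i j)
      (const (inverse (s * (r * s) ^ (i - 1)) * (s * (r * s) ^ (j - 1))) *
        (Lm_mat i j * c_poly n r s k))"
    using Lm_c_poly_commute[OF assms(2,1) i j] by (rule UR_cong_cancel) (simp add: assms)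
  moreover have "inverse (s * (r * s) ^ (i - 1)) * (s * (r * s) ^ (j - 1)) = z"
    using assms(1,2) by (simp add: z_def M'_entry_def field_simps)
  ultimately have "UR_cong n r s (c_poly n r s k * Lm_mat i j) (const z * (Lm_mat i j * c_poly n r s k))"
    by (simp only:)
  then show ?thesis
    using UR_class_eq[of n r s "c_poly n r s k * Lm_mat i j" "const z * (Lm_mat i j * c_poly n r s k)"]
      carrier_Lm_mat[OF i j] carrier_c_poly[of n r s k] carrier_const
    by (simp add: l_minus_def c_elem_class[OF assms(3)] UR_class_mult[symmetric] carrier_mult)
qed

lemma c_elem_quasi_central:
  assumes "r \<noteq> 0" "s \<noteq> 0" "k \<le> n"
  shows "quasi_central n r s (c_elem n r s k)"
  unfolding quasi_central_def
proof (intro conjI allI impI)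
  note c = c_elem_class[OF assms(3), of r s]
  show "c_elem n r s k \<in> carrier (UR n r s)" by (simp add: c UR_class_closed carrier_c_poly)
  fix i j assume "1 \<le> i \<and> i \<le> j \<and> j \<le> n"
  then have i: "i \<in> {1..n}" and j: "j \<in> {1..n}" by auto
  let ?z = "inverse (M_entry n r s i) * M_entry n r s j"
  have "l_plus n r s i j \<otimes>\<^bsub>UR n r s\<^esub> c_elem n r s k =
      UR_smult n r s ?z (c_elem n r s k \<otimes>\<^bsub>UR n r s\<^esub> l_plus n r s i j)"
    unfolding l_plus_c_elem[OF assms i j]
    by (simp add: c l_plus_def UR_smult_class UR_class_mult[symmetric] carrier_mult carrier_c_poly
        carrier_Lp_mat[OF i j])
  moreover have "?z \<noteq> 0" using assms by (simp add: M_entry_def)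
  ultimately show "\<exists>z. z \<noteq> 0 \<and> l_plus n r s i j \<otimes>\<^bsub>UR n r s\<^esub> c_elem n r s k =
      UR_smult n r s z (c_elem n r s k \<otimes>\<^bsub>UR n r s\<^esub> l_plus n r s i j)" by blast
  \<comment> \<open>The identity for \<open>L\<^sup>-\<close> has \<open>c\<^sub>k\<close> on the left, so the scalar needed here is the inverse of \<open>?w\<close>.\<close>
  let ?w = "inverse (M'_entry r s j) * M'_entry r s i"
  have w: "?w \<noteq> 0" using assms by (simp add: M'_entry_def)
  have "UR_smult n r s (inverse ?w) (c_elem n r s k \<otimes>\<^bsub>UR n r s\<^esub> l_minus n r s j i) =
      UR_class n r s (const (inverse ?w) * (const ?w * (Lm_mat j i * c_poly n r s k)))"
    unfolding c_elem_l_minus[OF assms j i]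
    by (intro UR_smult_class carrier_mult carrier_const carrier_c_poly carrier_Lm_mat i j)
  also have "const (inverse ?w) * (const ?w * (Lm_mat j i * c_poly n r s k)) = Lm_mat j i * c_poly n r s k"
    unfolding mult.assoc[symmetric, of "const (inverse ?w)"] const_mult[symmetric] left_inverse[OF w] by simp
  also have "UR_class n r s \<dots> = l_minus n r s j i \<otimes>\<^bsub>UR n r s\<^esub> c_elem n r s k"
    by (simp add: c l_minus_def UR_class_mult carrier_c_poly carrier_Lm_mat[OF j i])
  finally show "\<exists>z. z \<noteq> 0 \<and> l_minus n r s j i \<otimes>\<^bsub>UR n r s\<^esub> c_elem n r s k =
      UR_smult n r s z (c_elem n r s k \<otimes>\<^bsub>UR n r s\<^esub> l_minus n r s j i)"
    using w by (metis inverse_nonzero_iff_nonzero)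
qed

theorem theorem3p5:
  fixes n k :: nat and r s :: complex
  assumes "n \<ge> 2" and "r \<noteq> 0" and "s \<noteq> 0" and "r \<noteq> s"
    and "\<And>m. 1 \<le> m \<Longrightarrow> m \<le> n \<Longrightarrow> rs_number r s m \<noteq> 0"
    and "1 \<le> k" and "k \<le> n - 1"
  shows "quasi_central n r s (c_elem n r s k) \<and>
    (\<forall>i\<in>{1..n}. \<forall>j\<in>{1..n}.
       l_plus n r s i j \<otimes>\<^bsub>UR n r s\<^esub> c_elem n r s k =
       c_elem n r s k \<otimes>\<^bsub>UR n r s\<^esub>
         UR_mat_mult n r s
           (UR_mat_mult n r s (UR_diag n r s (\<lambda>i. inverse (M_entry n r s i))) (l_plus n r s))
           (UR_diag n r s (M_entry n r s)) i j) \<and>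
    (\<forall>i\<in>{1..n}. \<forall>j\<in>{1..n}.
       c_elem n r s k \<otimes>\<^bsub>UR n r s\<^esub> l_minus n r s i j =
       UR_mat_mult n r s
           (UR_mat_mult n r s (UR_diag n r s (\<lambda>i. inverse (M'_entry r s i))) (l_minus n r s))
           (UR_diag n r s (M'_entry r s)) i j
         \<otimes>\<^bsub>UR n r s\<^esub> c_elem n r s k)"
proof (intro conjI ballI)
  have kn: "k \<le> n" using assms(7) by simp
  note c = c_elem_class[OF kn, of r s]
  show "quasi_central n r s (c_elem n r s k)"
    by (rule c_elem_quasi_central[OF assms(2,3) kn])
  fix i j assume i: "i \<in> {1..n}" and j: "j \<in> {1..n}"
  have plus: "l_plus n r s = (\<lambda>i j. UR_class n r s (Lp_mat i j))" and
      minus: "l_minus n r s = (\<lambda>i j. UR_class n r s (Lm_mat i j))"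
    by (simp_all add: fun_eq_iff l_plus_def l_minus_def)
  have "UR_mat_mult n r s
         (UR_mat_mult n r s (UR_diag n r s (\<lambda>i. inverse (M_entry n r s i))) (l_plus n r s))
         (UR_diag n r s (M_entry n r s)) i j =
      UR_class n r s (const (inverse (M_entry n r s i) * M_entry n r s j) * Lp_mat i j)"
    unfolding plus by (rule UR_diag_conjugate[OF i j carrier_Lp_mat])
  then show "l_plus n r s i j \<otimes>\<^bsub>UR n r s\<^esub> c_elem n r s k =
       c_elem n r s k \<otimes>\<^bsub>UR n r s\<^esub>
         UR_mat_mult n r s
           (UR_mat_mult n r s (UR_diag n r s (\<lambda>i. inverse (M_entry n r s i))) (l_plus n r s))
           (UR_diag n r s (M_entry n r s)) i j"
    unfolding l_plus_c_elem[OF assms(2,3) kn i j]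
    by (simp add: c UR_class_mult[symmetric] carrier_c_poly carrier_mult carrier_const carrier_Lp_mat[OF i j]
        const_left_commute[of "c_poly n r s k"])
  have "UR_mat_mult n r s
           (UR_mat_mult n r s (UR_diag n r s (\<lambda>i. inverse (M'_entry r s i))) (l_minus n r s))
           (UR_diag n r s (M'_entry r s)) i j =
      UR_class n r s (const (inverse (M'_entry r s i) * M'_entry r s j) * Lm_mat i j)"
    unfolding minus by (rule UR_diag_conjugate[OF i j carrier_Lm_mat])
  then show "c_elem n r s k \<otimes>\<^bsub>UR n r s\<^esub> l_minus n r s i j =
       UR_mat_mult n r s
           (UR_mat_mult n r s (UR_diag n r s (\<lambda>i. inverse (M'_entry r s i))) (l_minus n r s))
           (UR_diag n r s (M'_entry r s)) i j
         \<otimes>\<^bsub>UR n r s\<^esub> c_elem n r s k"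
    unfolding c_elem_l_minus[OF assms(2,3) kn i j]
    by (simp add: c UR_class_mult[symmetric] carrier_c_poly carrier_mult carrier_const carrier_Lm_mat[OF i j]
        mult.assoc)
qed

end
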